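(* Let $K \subseteq \mathbb{R}^n$ be a compact convex set with $K \subseteq R\,\mathbb{B}_1^n$ for some $R \in \mathbb{N}$, and let $\mathcal{T}$ be a branching proof of integer infeasibility for $K$. Then there exists a branching proof $\mathcal{T}'$ of integer infeasibility for $K$ such that $|\mathcal{T}'| \leq C\, n\, |\mathcal{T}|$ for an absolute constant $C$, every edge $e$ of $\mathcal{T}'$ is labeled by an inequality $\mathbf{a}'_e \mathbf{x} \leq b'_e$ with $\mathbf{a}'_e \in \mathbb{Z}^n$, $b'_e \in \mathbb{Z}$ and $$\max\{\|\mathbf{a}'_e\|_\infty, |b'_e|\} \leq (10nR)^{(n+2)^2},$$ and the bit-size satisfies $\langle \mathcal{T}' \rangle = O(n^3 \log_2(2nR)\, |\mathcal{T}|)$.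
   Context: $\mathbb{B}_1^n = \{\mathbf{x}\in\mathbb{R}^n : \|\mathbf{x}\|_1 \le 1\}$. A branching proof of integer infeasibility for a convex set $K\subseteq\mathbb{R}^n$ is a finite rooted tree $\mathcal{T}$ in which every internal node $v$ is labeled by a pair $(\mathbf{a}_v,b_v)\in\mathbb{Z}^n\times\mathbb{Z}$ and has exactly two children $v_l,v_r$; the edge $(v,v_l)$ is labeled with the inequality $\mathbf{a}_v\mathbf{x}\le b_v$ and the edge $(v,v_r)$ with $-\mathbf{a}_v\mathbf{x}\le -b_v-1$ (i.e. $\mathbf{a}_v\mathbf{x}\ge b_v+1$). For a node $v$, $K_v$ denotes $K$ intersected with all inequalities labeling the edges on the path from the root to $v$ (so $K_{\text{root}}=K$). $\mathcal{T}$ is valid if $K_v=\emptyset$ for every leaf $v$. The length $|\mathcal{T}|$ is the number of nodes. Bit-sizes: for a rational $r=p/q$ ($p,q\in\mathbb{Z}$, $q>0$, in lowest terms) $\langle r\rangle = 1+\lceil\log_2(|p|+1)\rceil+\lceil\log_2(q+1)\rceil$; for $\mathbf{c}\in\mathbb{Q}^n$, $\langle \mathbf{c}\rangle = n+\sum_i\langle c_i\rangle$; for a matrix, $\langle \mathsf{A}\rangle = mn+\sum_{i,j}\langle \mathsf{A}_{ij}\rangle$; $\langle A,B\rangle=\langle A\rangle+\langle B\rangle$. For a labeled rooted tree with node set $V$ and edge set $E$, $\langle\mathcal{T}\rangle = |V|+|E|+\sum_{e\in E}\langle L_e\rangle+\sum_{v\in V}\langle L_v\rangle$, where $L_e,L_v$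 are the edge and node labels (an inequality $\mathbf{a}\mathbf{x}\le b$ has bit-size $\langle \mathbf{a},b\rangle$). *)

theory Defs
  imports "HOL-Analysis.Analysis"
begin

text \<open>Points of R^n are represented as functions nat => real vanishing outside {0..<n}
  (the space nat => real carries the product topology from HOL-Analysis);
  integer vectors in Z^n are functions nat => int of which only the first n
  components are used.\<close>

definition lin :: "nat \<Rightarrow> (nat \<Rightarrow> int) \<Rightarrow> (nat \<Rightarrow> real) \<Rightarrow> real" where
  "lin n a x = (\<Sum>i<n. real_of_int (a i) * x i)"

definition in_Rn :: "nat \<Rightarrow> (nat \<Rightarrow> real) set" where
  "in_Rn n = {x. \<forall>i\<ge>n. x i = 0}"

definition norm1 :: "nat \<Rightarrow> (nat \<Rightarrow> real) \<Rightarrow> real" where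
  "norm1 n x = (\<Sum>i<n. \<bar>x i\<bar>)"

definition convex_set :: "(nat \<Rightarrow> real) set \<Rightarrow> bool" where
  "convex_set K \<longleftrightarrow> (\<forall>x\<in>K. \<forall>y\<in>K. \<forall>t::real. 0 \<le> t \<and> t \<le> 1 \<longrightarrow>
      (\<lambda>i. (1 - t) * x i + t * y i) \<in> K)"

text \<open>Branching trees: a leaf, or an internal node labelled (a,b) with left child
  (edge a x <= b) and right child (edge -a x <= -b-1).\<close>
datatype btree = Leaf | Node "nat \<Rightarrow> int" int btree btree

primrec valid :: "nat \<Rightarrow> (nat \<Rightarrow> real) set \<Rightarrow> btree \<Rightarrow> bool" where
  "valid n K Leaf \<longleftrightarrow> K = {}"
| "valid n K (Node a b l r) \<longleftrightarrow>
     valid n (K \<inter> {x. lin n a x \<le> of_int b}) l \<and>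
     valid n (K \<inter> {x. - lin n a x \<le> of_int (- b - 1)}) r"

primrec tsize :: "btree \<Rightarrow> nat" where
  "tsize Leaf = 1"
| "tsize (Node a b l r) = 1 + tsize l + tsize r"

primrec all_edges :: "((nat \<Rightarrow> int) \<Rightarrow> int \<Rightarrow> bool) \<Rightarrow> btree \<Rightarrow> bool" where
  "all_edges P Leaf = True"
| "all_edges P (Node a b l r) \<longleftrightarrow>
     P a b \<and> P (\<lambda>i. - a i) (- b - 1) \<and> all_edges P l \<and> all_edges P r"

definition bits_rat :: "rat \<Rightarrow> nat" where
  "bits_rat r = (case quotient_of r of (p, q) \<Rightarrow>
      1 + nat \<lceil>log 2 (real_of_int (\<bar>p\<bar> + 1))\<rceil> + nat \<lceil>log 2 (real_of_int (q + 1))\<rceil>)"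

definition bits_vec :: "nat \<Rightarrow> (nat \<Rightarrow> int) \<Rightarrow> nat" where
  "bits_vec n a = n + (\<Sum>i<n. bits_rat (of_int (a i)))"

definition bits_ineq :: "nat \<Rightarrow> (nat \<Rightarrow> int) \<Rightarrow> int \<Rightarrow> nat" where
  "bits_ineq n a b = bits_vec n a + bits_rat (of_int b)"

text \<open>Bit-size |V| + |E| + sum of edge-label sizes + sum of node-label sizes
  (leaves carry no label).\<close>
primrec tbits :: "nat \<Rightarrow> btree \<Rightarrow> nat" where
  "tbits n Leaf = 1"
| "tbits n (Node a b l r) = 1 + 2 + bits_ineq n a b
     + bits_ineq n a b + bits_ineq n (\<lambda>i. - a i) (- b - 1)
     + tbits n l + tbits n r"

end

theory Submission
  imports Defs
begin

text \<open>Write a halfspace \<open>a x \<le> b\<close> as \<open>v \<cdot> (x, -1) \<le> 0\<close> with \<open>v = (a, b)\<close>.  Iterated simultaneous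
  Dirichlet approximation, each round killing the largest coordinate of the residual, expands \<open>v\<close>
  as \<open>\<alpha>\<^sub>1 p\<^sub>1 + \<dots> + \<alpha>\<^sub>k p\<^sub>k + c\<close> with \<open>k \<le> n + 1\<close>, small integer vectors \<open>p\<^sub>i\<close> and a residual \<open>c\<close>
  that is either zero or small; since only the fractional parts of the \<open>\<alpha>\<^sub>i\<close> matter on the flat
  where all \<open>p\<^sub>i\<close> vanish, there \<open>v\<close> agrees with a small integer vector \<open>a'\<close>.  Every node of
  the tree is relabelled by a lexicographic combination of \<open>p\<^sub>1, \<dots>, p\<^sub>k, a'\<close>.

  The cells of the new leaves need not be empty.  But if, for every edge on the path to a leaf, the
  current \<open>p\<^sub>i\<close> took a value \<open>\<le> -1\<close> somewhere on the cell, then averaging such points over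
  any \<open>n + 1\<close> edges gives a point satisfying the original inequalities of these edges, and Helly's
  theorem produces a point of the original, empty, cell.  So some \<open>p\<^sub>i\<close> is \<open>> -1\<close> and \<open>< 1\<close>
  on the cell, and two branchings restrict the cell to \<open>p\<^sub>i = 0\<close>.  The dimension drops at most
  \<open>n\<close> times, and only the \<open>p\<^sub>i\<close>, which are shorter by a factor \<open>n\<close> in bit-size, are used here.\<close>

section \<open>Linear dependence, Helly's theorem, and triangular families of functionals\<close>

text \<open>Gaussian elimination: unless the last equation is vacuous, it is solved for a pivot
  unknown \<open>k\<close>, and substitution leaves one equation and one unknown fewer.\<close>

lemma homogeneous_system_nontrivial:
  fixes A :: "nat \<Rightarrow> 'i \<Rightarrow> real"
  assumes "finite I" "m < card I"
  shows "\<exists>c. (\<exists>i\<in>I. c i \<noteq> 0) \<and> (\<forall>r<m. (\<Sum>i\<in>I. A r i * c i) = 0)"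
  using assms
proof (induction m arbitrary: I A)
  case 0
  then show ?case by (intro exI[of _ "\<lambda>_. 1"]) (auto simp: card_gt_0_iff)
next
  case (Suc m)
  show ?case
  proof (cases "\<forall>i\<in>I. A m i = 0")
    case True
    obtain c where "\<exists>i\<in>I. c i \<noteq> 0" "\<forall>r<m. (\<Sum>i\<in>I. A r i * c i) = 0"
      using Suc.IH[of I A] Suc.prems by auto
    moreover have "(\<Sum>i\<in>I. A m i * c i) = 0" using True by simp
    ultimately show ?thesis by (auto simp: less_Suc_eq)
  next
    case False
    then obtain k where k: "k \<in> I" "A m k \<noteq> 0" by auto
    define J where "J = I - {k}"
    have fJ: "finite J" "m < card J" "k \<notin> J" using Suc.prems k by (auto simp: J_def)
    have IJ: "I = insert k J" using k by (auto simp: J_def)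
    obtain c where c: "\<exists>i\<in>J. c i \<noteq> 0"
      "\<forall>r<m. (\<Sum>i\<in>J. (A r i - A r k * A m i / A m k) * c i) = 0"
      using Suc.IH[OF fJ(1,2), of "\<lambda>r i. A r i - A r k * A m i / A m k"] by auto
    define s where "s = (\<Sum>i\<in>J. A m i * c i)"
    define d where "d = c(k := - s / A m k)"
    have sumd: "(\<Sum>i\<in>I. A r i * d i) = A r k * (- s / A m k) + (\<Sum>i\<in>J. A r i * c i)" for r
    proof -
      have "(\<Sum>i\<in>J. A r i * d i) = (\<Sum>i\<in>J. A r i * c i)"
        using fJ(3) by (intro sum.cong) (auto simp: d_def)
      then show ?thesis unfolding IJ using fJ by (simp add: d_def)
    qed
    have "(\<Sum>i\<in>I. A r i * d i) = 0" if "r < Suc m" for r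
    proof (cases "r = m")
      case True
      then show ?thesis using sumd[of m] k(2) by (simp add: s_def)
    next
      case False
      with that have "(\<Sum>i\<in>J. (A r i - A r k * A m i / A m k) * c i) = 0" using c(2) by auto
      moreover have "(\<Sum>i\<in>J. (A r i - A r k * A m i / A m k) * c i)
        = (\<Sum>i\<in>J. A r i * c i) - A r k / A m k * s"
        by (simp add: s_def sum_distrib_left algebra_simps flip: sum_subtractf)
      ultimately show ?thesis using sumd[of r] by simp
    qed
    moreover have "\<exists>i\<in>I. d i \<noteq> 0" using c(1) fJ(3) unfolding IJ d_def by auto
    ultimately show ?thesis by blast
  qed
qed

lemma convex_setD:
  assumes "convex_set C" "x \<in> C" "y \<in> C" "0 \<le> t" "t \<le> (1::real)"
  shows "(\<lambda>i. (1 - t) * x i + t * y i) \<in> C"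
  using assms unfolding convex_set_def by simp

lemma convex_set_convex_combination:
  assumes "convex_set C" "finite F"
    and "\<And>i. i \<in> F \<Longrightarrow> 0 \<le> c i" "sum c F = 1" "\<And>i. i \<in> F \<Longrightarrow> x i \<in> C"
  shows "(\<lambda>k. \<Sum>i\<in>F. c i * x i k) \<in> C"
  using assms(2-)
proof (induction F arbitrary: c rule: finite_induct)
  case empty
  then show ?case by simp
next
  case (insert j F)
  show ?case
  proof (cases "c j = 1")
    case True
    then have "sum c F = 0" using insert by simp
    then have "\<forall>i\<in>F. c i = 0" using insert by (simp add: sum_nonneg_eq_0_iff)
    then have "(\<lambda>k. \<Sum>i\<in>insert j F. c i * x i k) = x j" using insert True by simp
    then show ?thesis using insert by simp
  next
    case False
    define s where "s = sum c F"
    have s: "s = 1 - c j" "s \<noteq> 0" "s \<ge> 0" using insert False by (auto simp: s_def sum_nonneg)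
    have "(\<lambda>k. \<Sum>i\<in>F. c i / s * x i k) \<in> C"
      using insert s by (intro insert.IH) (auto simp: s_def simp flip: sum_divide_distrib)
    moreover have "x j \<in> C" "0 \<le> s" "s \<le> 1" using insert s by auto
    ultimately have "(\<lambda>k. (1 - s) * x j k + s * (\<Sum>i\<in>F. c i / s * x i k)) \<in> C"
      using convex_setD[OF assms(1)] by simp
    moreover have "(\<lambda>k. (1 - s) * x j k + s * (\<Sum>i\<in>F. c i / s * x i k))
      = (\<lambda>k. \<Sum>i\<in>insert j F. c i * x i k)"
      using insert s by (simp add: sum_distrib_left)
    ultimately show ?thesis by simp
  qed
qed

text \<open>The coordinates give \<open>n\<close> equations and the all-ones row \<open>n\<close>
  encodes \<open>sum c I = 0\<close>, so \<open>n + 2\<close> unknowns suffice.\<close>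

lemma radon_dependence:
  assumes "finite I" "n + 2 \<le> card I" "\<And>i. i \<in> I \<Longrightarrow> x i \<in> in_Rn n"
  shows "\<exists>c. (\<exists>i\<in>I. c i \<noteq> 0) \<and> sum c I = 0 \<and> (\<forall>k. (\<Sum>i\<in>I. c i * x i k) = 0)"
proof -
  obtain c where c: "\<exists>i\<in>I. c i \<noteq> 0"
    "\<forall>r<n+1. (\<Sum>i\<in>I. (if r = n then 1 else x i r) * c i) = 0"
    using homogeneous_system_nontrivial[of I "n+1" "\<lambda>r i. if r = n then 1 else x i r"] assms by auto
  have "sum c I = 0" using c(2)[rule_format, of n] by simp
  moreover have "(\<Sum>i\<in>I. c i * x i k) = 0" for k
  proof (cases "k < n")
    case True
    then show ?thesis using c(2)[rule_format, of k] by (simp add: mult.commute)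
  next
    case False
    then show ?thesis using assms(3) by (auto simp: in_Rn_def intro!: sum.neutral)
  qed
  ultimately show ?thesis using c(1) by blast
qed

text \<open>Radon's argument, by induction on the number of sets: points \<open>x i\<close> common
  to all sets but \<open>C i\<close> are affinely dependent, and separating the positive
  coefficients from the others gives one point \<open>z\<close> with two convex
  representations.\<close>

lemma helly_in_Rn:
  assumes "finite I" "I \<noteq> {}"
    and cvx: "\<And>i. i \<in> I \<Longrightarrow> convex_set (C i)" and sub: "\<And>i. i \<in> I \<Longrightarrow> C i \<subseteq> in_Rn n"
    and small: "\<And>J. J \<subseteq> I \<Longrightarrow> J \<noteq> {} \<Longrightarrow> card J \<le> n + 1 \<Longrightarrow> (\<Inter>i\<in>J. C i) \<noteq> {}"
  shows "(\<Inter>i\<in>I. C i) \<noteq> {}"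
  using assms
proof (induction "card I" arbitrary: I rule: less_induct)
  case less
  show ?case
  proof (cases "card I \<le> n + 1")
    case True
    then show ?thesis using less.prems(5)[OF order_refl less.prems(2)] by simp
  next
    case False
    have "\<exists>y. y \<in> (\<Inter>j\<in>I-{i}. C j)" if "i \<in> I" for i
    proof -
      have less_card: "card (I - {i}) < card I" using that less.prems(1) by (intro psubset_card_mono) auto
      have ne: "I - {i} \<noteq> {}"
        using False card_mono[of "{i}" I] by auto
      have "(\<Inter>j\<in>I-{i}. C j) \<noteq> {}"
      proof (rule less.hyps[OF less_card _ ne])
        show "finite (I - {i})" using less.prems(1) by simp
        show "convex_set (C j)" "C j \<subseteq> in_Rn n" if "j \<in> I - {i}" for j
          using less.prems(3,4) that by blast+
        show "(\<Inter>i\<in>J. C i) \<noteq> {}" if "J \<subseteq> I - {i}" "J \<noteq> {}" "card J \<le> n + 1" for J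
          using less.prems(5) that by (metis Diff_subset order_trans)
      qed
      then show ?thesis by blast
    qed
    then have "\<forall>i\<in>I. \<exists>y. y \<in> (\<Inter>j\<in>I-{i}. C j)" by blast
    from bchoice[OF this] obtain x where x': "\<forall>i\<in>I. x i \<in> (\<Inter>j\<in>I-{i}. C j)" by blast
    have x: "x i \<in> C j" if "i \<in> I" "j \<in> I" "i \<noteq> j" for i j
      using x' that by blast
    have xin: "x i \<in> in_Rn n" if "i \<in> I" for i
    proof -
      have "\<not> I \<subseteq> {i}" using False card_mono[of "{i}" I] by auto
      then obtain j where "j \<in> I" "j \<noteq> i" by auto
      then show ?thesis using x[OF that] less.prems(4) by blast
    qed
    obtain c where c: "\<exists>i\<in>I. c i \<noteq> 0" "sum c I = 0" "\<And>k. (\<Sum>i\<in>I. c i * x i k) = 0"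
      using radon_dependence[of I n x] less.prems(1) False xin by auto
    define P where "P = {i\<in>I. c i > 0}"
    define L where "L = sum c P"
    define z where "z = (\<lambda>k. \<Sum>i\<in>P. c i / L * x i k)"
    have fin: "finite P" "finite (I - P)" "P \<subseteq> I" using less.prems(1) by (auto simp: P_def)
    have split: "sum f I = sum f P + sum f (I - P)" for f :: "'a \<Rightarrow> real"
      using sum.subset_diff[OF fin(3) less.prems(1)] by (simp add: add.commute)
    have "\<exists>i\<in>I. c i > 0"
    proof (rule ccontr)
      assume "\<not> (\<exists>i\<in>I. c i > 0)"
      then have nonneg: "\<And>i. i \<in> I \<Longrightarrow> 0 \<le> - c i" by force
      have "(\<Sum>i\<in>I. - c i) = 0" using c(2) by (simp add: sum_negf)
      then have "\<forall>i\<in>I. - c i = 0"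
        using sum_nonneg_eq_0_iff[OF less.prems(1) nonneg] by simp
      then show False using c(1) by auto
    qed
    then obtain k where k: "k \<in> P" "c k > 0" by (auto simp: P_def)
    have L: "L > 0" unfolding L_def
      by (rule sum_pos2[where i = k]) (use fin k in \<open>auto simp: P_def\<close>)
    have z2: "z = (\<lambda>k. \<Sum>i\<in>I-P. (- c i) / L * x i k)"
    proof
      fix k
      have "(\<Sum>i\<in>P. c i * x i k) = - (\<Sum>i\<in>I-P. c i * x i k)" using c(3)[of k] split[of "\<lambda>i. c i * x i k"] by (simp add: eq_neg_iff_add_eq_0)
      then show "z k = (\<Sum>i\<in>I-P. (- c i) / L * x i k)"
        by (simp add: z_def sum_negf sum_divide_distrib[symmetric])
    qed
    \<comment> \<open>\<open>x i\<close> lies in \<open>C j\<close> for every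
      \<open>i \<noteq> j\<close>, so each \<open>C j\<close> uses the representation of
      \<open>z\<close> whose indices avoid \<open>j\<close>.\<close>
    have "z \<in> C j" if j: "j \<in> I" for j
    proof (cases "j \<in> P")
      case False
      show ?thesis unfolding z_def
      proof (rule convex_set_convex_combination)
        show "sum (\<lambda>i. c i / L) P = 1" using L by (simp add: L_def flip: sum_divide_distrib)
        show "convex_set (C j)" using less.prems(3) j by blast
        show "\<And>i. i \<in> P \<Longrightarrow> x i \<in> C j" using x j False fin by blast
      qed (use fin L in \<open>auto simp: P_def\<close>)
    next
      case True
      show ?thesis unfolding z2
      proof (rule convex_set_convex_combination)
        have "sum c (I - P) = - L" using c(2) split[of c] by (simp add: L_def)
        then show "sum (\<lambda>i. - c i / L) (I - P) = 1" using L by (simp add: sum_negf flip: sum_divide_distrib)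
        show "convex_set (C j)" using less.prems(3) j by blast
        show "\<And>i. i \<in> I - P \<Longrightarrow> x i \<in> C j" using x j True fin by blast
      qed (use fin L in \<open>auto simp: P_def divide_nonpos_pos\<close>)
    qed
    then show ?thesis by blast
  qed
qed

text \<open>The witnesses force linear independence: evaluated at the witness of its last nonzero
  coefficient, a dependence retains only that term, because the earlier functionals vanish
  there.\<close>

lemma triangular_family_length:
  assumes "\<And>j. j < m \<Longrightarrow> \<exists>z. lin n (w j) z \<noteq> 0 \<and> (\<forall>i<j. lin n (w i) z = 0)"
  shows "m \<le> n"
proof (rule ccontr)
  assume "\<not> m \<le> n"
  then obtain c where c: "\<exists>j\<in>{..<m}. c j \<noteq> 0"
    "\<forall>r<n. (\<Sum>j<m. real_of_int (w j r) * c j) = 0"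
    using homogeneous_system_nontrivial[of "{..<m}" n "\<lambda>r j. real_of_int (w j r)"] by auto
  define j where "j = Max {j. j < m \<and> c j \<noteq> 0}"
  have fin: "finite {j. j < m \<and> c j \<noteq> 0}" by simp
  have jin: "j < m" "c j \<noteq> 0" using c(1) Max_in[OF fin] unfolding j_def by blast+
  have jmax: "c i = 0" if "j < i" "i < m" for i
    using Max_ge[OF fin, of i] that unfolding j_def by fastforce
  obtain z where z: "lin n (w j) z \<noteq> 0" "\<forall>i<j. lin n (w i) z = 0" using assms jin by blast
  have "0 = (\<Sum>r<n. (\<Sum>i<m. real_of_int (w i r) * c i) * z r)" using c(2) by simp
  also have "\<dots> = (\<Sum>i<m. c i * lin n (w i) z)"
    unfolding lin_def sum_distrib_left sum_distrib_right
    by (subst sum.swap) (simp add: mult_ac)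
  also have "\<dots> = (\<Sum>i\<in>{j}. c i * lin n (w i) z)"
    using jin z jmax by (intro sum.mono_neutral_right) (auto simp: neq_iff)
  finally show False using z jin by simp
qed

section \<open>Halfspaces and their relation to the cells of the new tree\<close>

text \<open>Entry \<open>n\<close> of \<open>v\<close> stores the right-hand side: \<open>ev n v x \<le> 0\<close> is \<open>a x \<le> b\<close> for \<open>v = (a, b)\<close>.\<close>

definition ev :: "nat \<Rightarrow> (nat \<Rightarrow> int) \<Rightarrow> (nat \<Rightarrow> real) \<Rightarrow> real" where
  "ev n v x = lin n v x - of_int (v n)"

text \<open>\<open>us\<close> are the vectors \<open>p\<^sub>i\<close> of one edge (negated on a right edge), \<open>S\<close> is a new cell, and \<open>G\<close> is the
  halfspace of the original edge.\<close>

primrec resolves :: "nat \<Rightarrow> real \<Rightarrow> (nat \<Rightarrow> real) set \<Rightarrow> (nat \<Rightarrow> int) list \<Rightarrow> (nat \<Rightarrow> real) set \<Rightarrow> bool" where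
  "resolves n \<epsilon> S [] G \<longleftrightarrow> S \<subseteq> G"
| "resolves n \<epsilon> S (u # us) G \<longleftrightarrow>
     (\<forall>x\<in>S. ev n u x \<le> \<epsilon> \<and> (ev n u x \<le> - \<epsilon> \<longrightarrow> x \<in> G)) \<and>
     resolves n \<epsilon> (S \<inter> {x. ev n u x = 0}) us G"

lemma resolves_antimono:
  "resolves n \<epsilon> S us G \<Longrightarrow> S' \<subseteq> S \<Longrightarrow> resolves n \<epsilon> S' us G"
proof (induction us arbitrary: S S')
  case Nil
  then show ?case by auto
next
  case (Cons u us)
  have sub: "S' \<inter> {x. ev n u x = 0} \<subseteq> S \<inter> {x. ev n u x = 0}" using Cons.prems(2) by blast
  have "resolves n \<epsilon> (S' \<inter> {x. ev n u x = 0}) us G"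
    using Cons.prems(1) by (intro Cons.IH[OF _ sub]) simp
  then show ?case using Cons.prems by (simp add: subset_iff)
qed

lemma valid_antimono: "valid n K T \<Longrightarrow> K' \<subseteq> K \<Longrightarrow> valid n K' T"
proof (induction T arbitrary: K K')
  case (Node a b l r)
  then show ?case
    by simp (meson Int_mono order_refl)
qed auto

lemma lin_sum: "lin n a (\<lambda>k. \<Sum>i\<in>F. c i * x i k) = (\<Sum>i\<in>F. c i * lin n a (x i))"
  unfolding lin_def sum_distrib_left by (subst sum.swap) (simp add: mult_ac)

lemma lin_affine: "lin n a (\<lambda>i. (1 - t) * x i + t * y i) = (1 - t) * lin n a x + t * lin n a y"
  unfolding lin_def sum_distrib_left sum.distrib[symmetric] by (simp add: algebra_simps)

lemma lin_diff: "lin n a (\<lambda>i. x i - y i) = lin n a x - lin n a y"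
  unfolding lin_def sum_subtractf[symmetric] by (simp add: algebra_simps)

lemma lin_uminus: "lin n (\<lambda>i. - a i) x = - lin n a x"
  unfolding lin_def by (simp add: sum_negf)

lemma convex_set_Int: "convex_set A \<Longrightarrow> convex_set B \<Longrightarrow> convex_set (A \<inter> B)"
  unfolding convex_set_def by simp

lemma convex_set_lin_le: "convex_set {x. lin n a x \<le> c}"
  unfolding convex_set_def mem_Collect_eq lin_affine
  by (auto intro!: convex_bound_le)

lemma convex_set_lin_ge: "convex_set {x. c \<le> lin n a x}"
  using convex_set_lin_le[of n "\<lambda>i. - a i" "- c"] by (simp add: lin_uminus)

lemma convex_set_ev_le: "convex_set {x. ev n v x \<le> c}"
  using convex_set_lin_le[of n v "c + of_int (v n)"] by (simp add: ev_def algebra_simps)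

lemma convex_set_ev_ge: "convex_set {x. c \<le> ev n v x}"
  using convex_set_lin_ge[of "c + of_int (v n)" n v] by (simp add: ev_def algebra_simps)

lemma convex_set_ev_eq: "convex_set {x. ev n v x = c}"
proof -
  have "{x. ev n v x = c} = {x. ev n v x \<le> c} \<inter> {x. c \<le> ev n v x}" by auto
  then show ?thesis using convex_set_Int convex_set_ev_le convex_set_ev_ge by metis
qed

section \<open>Averaging by Helly's theorem and repair of the leaves\<close>

text \<open>By Helly it suffices to treat \<open>f \<le> n + 1\<close> edges. In the average of
  their points, each edge receives at most \<open>-1\<close> from its own point and
  \<open>\<epsilon>\<close> from every other one;
  \<open>- 1 + (f - 1) * \<epsilon> \<le> - f * \<epsilon>\<close> follows from
  \<open>2 * f * \<epsilon> \<le> 1\<close>, which dictates the value of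
  \<open>\<epsilon>\<close>.\<close>

lemma helly_averaging:
  assumes eps: "\<epsilon> = 1 / (2 * (real n + 1))"
    and S: "convex_set S" "S \<subseteq> in_Rn n" and I: "finite I" "I \<noteq> {}"
    and G: "\<And>i. i \<in> I \<Longrightarrow> convex_set (G i)"
    and u: "\<And>i x. i \<in> I \<Longrightarrow> x \<in> S \<Longrightarrow> ev n (u i) x \<le> \<epsilon>"
    and uG: "\<And>i x. i \<in> I \<Longrightarrow> x \<in> S \<Longrightarrow> ev n (u i) x \<le> - \<epsilon> \<Longrightarrow> x \<in> G i"
    and strict: "\<And>i. i \<in> I \<Longrightarrow> \<exists>x\<in>S. ev n (u i) x \<le> - 1"
  shows "S \<inter> (\<Inter>i\<in>I. G i) \<noteq> {}"
proof -
  have "\<forall>i\<in>I. \<exists>x. x \<in> S \<and> ev n (u i) x \<le> - 1" using strict by blast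
  from bchoice[OF this] obtain x where x: "\<And>i. i \<in> I \<Longrightarrow> x i \<in> S" "\<And>i. i \<in> I \<Longrightarrow> ev n (u i) (x i) \<le> - 1"
    by blast
  have "(\<Inter>i\<in>I. S \<inter> G i) \<noteq> {}"
  proof (rule helly_in_Rn[OF I])
    show "convex_set (S \<inter> G i)" if "i \<in> I" for i using convex_set_Int S G that by blast
    show "S \<inter> G i \<subseteq> in_Rn n" for i using S by blast
    fix J assume J: "J \<subseteq> I" "J \<noteq> {}" "card J \<le> n + 1"
    have fJ: "finite J" using J I finite_subset by blast
    define f where "f = real (card J)"
    have f: "f \<ge> 1" "f \<le> real n + 1" using J fJ by (auto simp: f_def Suc_le_eq card_gt_0_iff)
    define z where "z = (\<lambda>k. \<Sum>i\<in>J. 1 / f * x i k)"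
    have zS: "z \<in> S" unfolding z_def
      by (rule convex_set_convex_combination[OF S(1) fJ]) (use f x J in \<open>auto simp: f_def\<close>)
    have "z \<in> G i" if i: "i \<in> J" for i
    proof (rule uG[OF _ zS])
      show "i \<in> I" using i J by blast
      have "lin n (u i) z = (\<Sum>j\<in>J. 1 / f * lin n (u i) (x j))" unfolding z_def by (rule lin_sum)
      also have "\<dots> = (\<Sum>j\<in>J. lin n (u i) (x j)) / f" by (simp add: sum_divide_distrib)
      finally have "f * ev n (u i) z = (\<Sum>j\<in>J. ev n (u i) (x j))"
        using f by (simp add: ev_def sum_subtractf right_diff_distrib flip: f_def)
      also have "\<dots> = ev n (u i) (x i) + (\<Sum>j\<in>J-{i}. ev n (u i) (x j))"
        using fJ i by (simp add: sum.remove)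
      also have "\<dots> \<le> - 1 + (\<Sum>j\<in>J-{i}. \<epsilon>)"
        using x u i J by (intro add_mono sum_mono) blast+
      also have "(\<Sum>j\<in>J-{i}. \<epsilon>) = (f - 1) * \<epsilon>"
        using fJ i f by (simp add: f_def)
      finally have "f * ev n (u i) z \<le> - 1 + (f - 1) * \<epsilon>" .
      moreover have "2 * f * \<epsilon> \<le> 1" using f unfolding eps by (simp add: field_simps)
      moreover have "\<epsilon> > 0" using eps by simp
      ultimately have "f * ev n (u i) z \<le> f * (- \<epsilon>)" by (simp add: algebra_simps)
      then show "ev n (u i) z \<le> - \<epsilon>" using f by (simp only: mult_le_cancel_left_pos)
    qed
    then show "(\<Inter>i\<in>J. S \<inter> G i) \<noteq> {}" using zS by blast
  qed
  then show ?thesis using I(2) by auto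
qed

definition bounded_edge :: "nat \<Rightarrow> int \<Rightarrow> (nat \<Rightarrow> int) \<Rightarrow> int \<Rightarrow> bool" where
  "bounded_edge n Z a b \<longleftrightarrow> (\<forall>i<n. \<bar>a i\<bar> \<le> Z) \<and> \<bar>b\<bar> \<le> Z"

text \<open>The outer \<open>Leaf\<close> receives the part with \<open>ev n u x \<ge> 1\<close>,
  the inner one the part with \<open>ev n u x \<le> -1\<close>, so \<open>t\<close> only has to deal
  with the flat \<open>ev n u x = 0\<close>.\<close>

definition pin :: "nat \<Rightarrow> (nat \<Rightarrow> int) \<Rightarrow> btree \<Rightarrow> btree" where
  "pin n u t = Node u (u n) (Node u (u n - 1) Leaf t) Leaf"

lemma valid_pin:
  assumes "\<And>x. x \<in> S \<Longrightarrow> ev n u x < 1" "\<And>x. x \<in> S \<Longrightarrow> - 1 < ev n u x"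
    and "valid n (S \<inter> {x. ev n u x = 0}) t"
  shows "valid n S (pin n u t)"
proof -
  have "S \<inter> {x. lin n u x \<le> of_int (u n)} \<inter> {x. - lin n u x \<le> of_int (- (u n - 1) - 1)}
    = S \<inter> {x. ev n u x = 0}" by (auto simp: ev_def)
  moreover have "S \<inter> {x. lin n u x \<le> of_int (u n)} \<inter> {x. lin n u x \<le> of_int (u n - 1)} = {}"
    using assms(2) by (force simp: ev_def)
  moreover have "S \<inter> {x. - lin n u x \<le> of_int (- u n - 1)} = {}"
    using assms(1) by (force simp: ev_def)
  ultimately show ?thesis using assms(3) by (simp add: pin_def)
qed

lemma tsize_pin: "tsize (pin n u t) = tsize t + 4"
  by (simp add: pin_def)

text \<open>The extra 1 in \<open>Q + 1\<close> covers the right-hand sides \<open>u n - 1\<close>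
  and \<open>- u n - 1\<close>.\<close>

lemma all_edges_pin:
  assumes "\<And>i. i \<le> n \<Longrightarrow> \<bar>u i\<bar> \<le> Q" "all_edges (bounded_edge n (Q + 1)) t"
  shows "all_edges (bounded_edge n (Q + 1)) (pin n u t)"
proof -
  have "\<bar>u i\<bar> \<le> Q + 1" if "i < n" for i using assms(1)[of i] that by simp
  moreover have "\<bar>u n\<bar> \<le> Q" using assms(1) by simp
  ultimately show ?thesis using assms(2) by (auto simp: pin_def bounded_edge_def)
qed

text \<open>The list \<open>E\<close> holds the edges on the path to the leaf.  The \<open>w j\<close> are the functionals already
  pinned; the vectors \<open>z\<close> witness their independence and hence bound \<open>m\<close> by \<open>n\<close>.\<close>

lemma repair_leaf:
  fixes Q :: int and E :: "((nat \<Rightarrow> int) list \<times> (nat \<Rightarrow> real) set) list"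
  assumes eps: "\<epsilon> = 1 / (2 * (real n + 1))"
    and "convex_set S" "S \<subseteq> in_Rn n"
    and "\<And>us G. (us, G) \<in> set E \<Longrightarrow> convex_set G"
    and "\<And>us G. (us, G) \<in> set E \<Longrightarrow> resolves n \<epsilon> S us G"
    and "\<And>us G u i. (us, G) \<in> set E \<Longrightarrow> u \<in> set us \<Longrightarrow> i \<le> n \<Longrightarrow> \<bar>u i\<bar> \<le> Q"
    and "S \<inter> (\<Inter>e\<in>set E. snd e) = {}"
    and "\<And>j x y. j < m \<Longrightarrow> x \<in> S \<Longrightarrow> y \<in> S \<Longrightarrow> lin n (w j) x = lin n (w j) y"
    and "\<And>j. j < m \<Longrightarrow> \<exists>z. lin n (w j) z \<noteq> 0 \<and> (\<forall>i<j. lin n (w i) z = 0)"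
  shows "\<exists>t. valid n S t \<and> tsize t + 4 * m \<le> 4 * n + 5 \<and> all_edges (bounded_edge n (Q + 1)) t"
  using assms(2-)
\<comment> \<open>The measure counts the edges together with the vectors left in their lists: the
  case \<open>nil\<close> removes an edge, the case \<open>pin\<close> a vector.\<close>
proof (induction "sum_list (map (\<lambda>e. length (fst e) + 1) E)" arbitrary: E S m w rule: less_induct)
  case less
  note cvx = less.prems(1) and sub = less.prems(2) and Gcvx = less.prems(3)
    and res = less.prems(4) and bd = less.prems(5) and emp = less.prems(6)
    and const = less.prems(7) and tri = less.prems(8)
  have mn: "m \<le> n" using triangular_family_length[of m n w] tri by blast
  have eps1: "0 < \<epsilon>" "\<epsilon> < 1" unfolding eps by (simp_all add: field_simps)
  \<comment> \<open>Either some expansion is exhausted and its halfspace already contains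
    \<open>S\<close>, or some leading vector stays above \<open>-1\<close> and can be pinned, or all
    leading vectors reach \<open>-1\<close> and averaging applies.\<close>
  consider (nil) G where "([], G) \<in> set E"
    | (pin) u us G where "(u # us, G) \<in> set E" "\<And>x. x \<in> S \<Longrightarrow> - 1 < ev n u x"
    | (slack) "\<And>G. ([], G) \<notin> set E" "\<And>u us G. (u # us, G) \<in> set E \<Longrightarrow> \<exists>x\<in>S. ev n u x \<le> - 1"
    by (meson linorder_not_le neq_Nil_conv)
  then show ?case
  proof cases
    case nil
    then obtain E1 E2 where E: "E = E1 @ ([], G) # E2" by (meson split_list)
    have "S \<subseteq> G" using res[OF nil] by simp
    then have emp': "S \<inter> (\<Inter>e\<in>set (E1 @ E2). snd e) = {}" using emp E by auto
    have "set (E1 @ E2) \<subseteq> set E" by (auto simp: E)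
    then have sub': "\<And>e. e \<in> set (E1 @ E2) \<Longrightarrow> e \<in> set E" by blast
    show ?thesis
    proof (rule less.hyps[where E = "E1 @ E2" and S = S and m = m and w = w])
      show "sum_list (map (\<lambda>e. length (fst e) + 1) (E1 @ E2)) < sum_list (map (\<lambda>e. length (fst e) + 1) E)"
        by (simp add: E)
      show "\<bar>v i\<bar> \<le> Q" if "(vs, H) \<in> set (E1 @ E2)" "v \<in> set vs" "i \<le> n" for vs H v i
        by (rule bd[OF sub'[OF that(1)] that(2,3)])
    qed (fact cvx sub Gcvx[OF sub'] res[OF sub'] emp' const tri)+
  next
    case pin
    then obtain E1 E2 where E: "E = E1 @ (u # us, G) # E2" by (meson split_list)
    define E' where "E' = E1 @ (us, G) # E2"
    have ru: "\<forall>x\<in>S. ev n u x \<le> \<epsilon>" and r2: "resolves n \<epsilon> (S \<inter> {x. ev n u x = 0}) us G"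
      using res[OF pin(1)] by simp_all
    have r1: "ev n u x < 1" if "x \<in> S" for x using ru that eps1(2) by (meson le_less_trans)
    have ubd: "\<And>i. i \<le> n \<Longrightarrow> \<bar>u i\<bar> \<le> Q" using bd[OF pin(1)] by simp
    let ?S = "S \<inter> {x. ev n u x = 0}"
    have emp': "?S \<inter> (\<Inter>e\<in>set E'. snd e) = {}" using emp by (auto simp: E E'_def)
    have IH: "\<exists>t. valid n ?S t \<and> tsize t + 4 * m' \<le> 4 * n + 5 \<and> all_edges (bounded_edge n (Q + 1)) t"
      if "\<And>j x y. j < m' \<Longrightarrow> x \<in> ?S \<Longrightarrow> y \<in> ?S \<Longrightarrow> lin n (w' j) x = lin n (w' j) y"
        "\<And>j. j < m' \<Longrightarrow> \<exists>z. lin n (w' j) z \<noteq> 0 \<and> (\<forall>i<j. lin n (w' i) z = 0)" for m' w'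
    proof (rule less.hyps[where E = E' and S = ?S and m = m' and w = w'])
      show "sum_list (map (\<lambda>e. length (fst e) + 1) E') < sum_list (map (\<lambda>e. length (fst e) + 1) E)"
        by (simp add: E E'_def)
      show "convex_set ?S" using cvx convex_set_Int convex_set_ev_eq by blast
      show "?S \<subseteq> in_Rn n" using sub by blast
      show "convex_set H" if "(vs, H) \<in> set E'" for vs H using that Gcvx by (auto simp: E E'_def)
      show "resolves n \<epsilon> ?S vs H" if "(vs, H) \<in> set E'" for vs H
        using that r2 resolves_antimono[OF res[of vs H], of ?S] by (auto simp: E E'_def)
      show "\<bar>v i\<bar> \<le> Q" if "(vs, H) \<in> set E'" "v \<in> set vs" "i \<le> n" for vs H v i
        using that bd[of vs H v i] bd[OF pin(1), of v i] by (auto simp: E E'_def)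
      show "?S \<inter> (\<Inter>e\<in>set E'. snd e) = {}" by (rule emp')
    qed (fact that)+
    show ?thesis
    proof (cases "\<forall>x\<in>S. \<forall>y\<in>S. lin n u x = lin n u y")
      case True
      \<comment> \<open>The functional of \<open>u\<close> is constant on \<open>S\<close>, so no
        drop in dimension could pay for a branching. Either the flat misses \<open>S\<close> and a
        pinned \<open>Leaf\<close> of 5 nodes ends the repair, or \<open>S\<close> lies in the flat
        and \<open>u\<close> is discarded at no cost.\<close>
      show ?thesis
      proof (cases "?S = {}")
        case True
        have "valid n S (pin n u Leaf)" using valid_pin[OF r1 pin(2)] True by simp
        moreover have "all_edges (bounded_edge n (Q + 1)) (pin n u Leaf)"
          using all_edges_pin ubd by simp
        moreover have "tsize (pin n u Leaf) = 5" by (simp add: tsize_pin)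
        ultimately show ?thesis using mn by (intro exI[of _ "pin n u Leaf"]) simp
      next
        case False
        then obtain x where x: "x \<in> S" "lin n u x = of_int (u n)" by (auto simp: ev_def)
        have SS: "?S = S"
        proof -
          have "ev n u y = 0" if "y \<in> S" for y
            using True[rule_format, OF that x(1)] x(2) by (simp add: ev_def)
          then show ?thesis by blast
        qed
        show ?thesis
          by (rule IH[of m w, unfolded SS]) (fact const tri)+
      qed
    next
      case False
      then obtain x y where xy: "x \<in> S" "y \<in> S" "lin n u x \<noteq> lin n u y" by blast
      define w' where "w' = w(m := u)"
      obtain t where t: "valid n ?S t" "tsize t + 4 * Suc m \<le> 4 * n + 5" "all_edges (bounded_edge n (Q + 1)) t"
      proof (atomize_elim, rule IH)
        show "lin n (w' j) p = lin n (w' j) q" if "j < Suc m" "p \<in> ?S" "q \<in> ?S" for j p q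
        proof (cases "j = m")
          case True
          then show ?thesis using that(2,3) by (simp add: w'_def ev_def)
        next
          case False
          then have "j < m" using that(1) by simp
          then have "lin n (w j) p = lin n (w j) q" using const that(2,3) by blast
          then show ?thesis using False by (simp add: w'_def)
        qed
        show "\<exists>z. lin n (w' j) z \<noteq> 0 \<and> (\<forall>i<j. lin n (w' i) z = 0)" if "j < Suc m" for j
        proof (cases "j = m")
          case True
          \<comment> \<open>The witness for \<open>u\<close> is a difference of two points of
            \<open>S\<close>, on which the earlier functionals vanish since they are constant on
            \<open>S\<close>.\<close>
          have "lin n (w i) (\<lambda>i. x i - y i) = 0" if "i < m" for i
            unfolding lin_diff using const[OF that xy(1,2)] by (rule right_minus_eq[THEN iffD2])
          moreover have "lin n u (\<lambda>i. x i - y i) \<noteq> 0" unfolding lin_diff using xy(3) by simp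
          ultimately show ?thesis unfolding True w'_def by (intro exI[of _ "\<lambda>i. x i - y i"]) simp
        next
          case False
          then show ?thesis using tri[of j] that by (auto simp: w'_def)
        qed
      qed
      show ?thesis
      proof (intro exI conjI)
        show "valid n S (pin n u t)" using valid_pin[OF r1 pin(2) t(1)] .
        \<comment> \<open>The passage from \<open>m\<close> to \<open>Suc m\<close> pays for the
          four nodes added by \<open>pin\<close>.\<close>
        show "tsize (pin n u t) + 4 * m \<le> 4 * n + 5" using t(2) by (simp add: tsize_pin)
        show "all_edges (bounded_edge n (Q + 1)) (pin n u t)" by (rule all_edges_pin[OF ubd t(3)])
      qed
    qed
  next
    case slack
    have hd: "(hd (fst e) # tl (fst e), snd e) \<in> set E" if "e \<in> set E" for e
    proof -
      have "fst e \<noteq> []" using slack(1)[of "snd e"] that by (metis prod.collapse)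
      then show ?thesis using that by simp
    qed
    \<comment> \<open>Otherwise averaging yields a point of \<open>S\<close> in all original
      halfspaces. With no edge left, the empty intersection is \<open>S\<close> itself.\<close>
    have "E = []"
    proof (rule ccontr)
      assume "E \<noteq> []"
      have "S \<inter> (\<Inter>e\<in>set E. snd e) \<noteq> {}"
      proof (rule helly_averaging[OF eps cvx sub, where u = "\<lambda>e. hd (fst e)"])
        show "set E \<noteq> {}" using \<open>E \<noteq> []\<close> by simp
        fix e assume "e \<in> set E"
        note e = hd[OF this]
        show "convex_set (snd e)" by (rule Gcvx[OF e])
        show "\<exists>x\<in>S. ev n (hd (fst e)) x \<le> - 1" by (rule slack(2)[OF e])
        show "ev n (hd (fst e)) x \<le> \<epsilon>" if "x \<in> S" for x using res[OF e] that by simp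
        show "x \<in> snd e" if "x \<in> S" "ev n (hd (fst e)) x \<le> - \<epsilon>" for x using res[OF e] that by simp
      qed simp
      then show False using emp by blast
    qed
    then have "S = {}" using emp by simp
    then show ?thesis using mn by (intro exI[of _ Leaf]) simp
  qed
qed

section \<open>Expansion of a halfspace by simultaneous Dirichlet approximation\<close>

text \<open>Counterpart of \<open>ev\<close> for real coefficients, since the residuals of the
  expansion are real vectors.\<close>

definition evr :: "nat \<Rightarrow> (nat \<Rightarrow> real) \<Rightarrow> (nat \<Rightarrow> real) \<Rightarrow> real" where
  "evr n c x = (\<Sum>i<n. c i * x i) - c n"

lemma ev_eq_evr: "ev n v x = evr n (\<lambda>i. of_int (v i)) x"
  by (simp add: ev_def evr_def lin_def)

lemma evr_diff: "evr n (\<lambda>i. c i - d i) x = evr n c x - evr n d x"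
  by (simp add: evr_def sum_subtractf left_diff_distrib)

lemma evr_add: "evr n (\<lambda>i. c i + d i) x = evr n c x + evr n d x"
  by (simp add: evr_def sum.distrib distrib_right)

lemma evr_cmult: "evr n (\<lambda>i. k * c i) x = k * evr n c x"
  by (simp add: evr_def sum_distrib_left right_diff_distrib mult.assoc)

text \<open>Hoelder's inequality; the 1 in \<open>r + 1\<close> accounts for entry
  \<open>n\<close>.\<close>

lemma abs_evr_le:
  assumes "\<And>i. i \<le> n \<Longrightarrow> \<bar>c i\<bar> \<le> M" "norm1 n x \<le> r"
  shows "\<bar>evr n c x\<bar> \<le> (r + 1) * M"
proof -
  have M: "M \<ge> 0" using assms(1)[of n] by linarith
  have "\<bar>\<Sum>i<n. c i * x i\<bar> \<le> (\<Sum>i<n. \<bar>c i * x i\<bar>)" by (rule sum_abs)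
  also have "\<dots> \<le> (\<Sum>i<n. M * \<bar>x i\<bar>)"
    using assms(1) by (intro sum_mono) (auto simp: abs_mult intro!: mult_right_mono)
  also have "\<dots> = M * norm1 n x" by (simp add: norm1_def sum_distrib_left)
  also have "\<dots> \<le> M * r" using assms(2) M by (rule mult_left_mono)
  finally have "\<bar>\<Sum>i<n. c i * x i\<bar> \<le> M * r" .
  moreover have "\<bar>c n\<bar> \<le> M" using assms(1) by simp
  ultimately show ?thesis unfolding evr_def by (simp add: algebra_simps)
qed

text \<open>The expansion of \<open>v\<close> with vectors \<open>ps\<close> and exact tail \<open>a\<close>, recording only the sign information
  used later.\<close>

primrec chain :: "nat \<Rightarrow> real \<Rightarrow> (nat \<Rightarrow> int) \<Rightarrow> (nat \<Rightarrow> real) set \<Rightarrow> (nat \<Rightarrow> int) list \<Rightarrow> (nat \<Rightarrow> int) \<Rightarrow> bool" where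
  "chain n \<epsilon> v X [] a \<longleftrightarrow> (\<forall>x\<in>X. ev n v x = ev n a x)"
| "chain n \<epsilon> v X (p # ps) a \<longleftrightarrow>
     (\<forall>x\<in>X. (ev n p x \<le> - \<epsilon> \<longrightarrow> ev n v x \<le> 0) \<and> (\<epsilon> \<le> ev n p x \<longrightarrow> 1 \<le> ev n v x)) \<and>
     chain n \<epsilon> v (X \<inter> {x. ev n p x = 0}) ps a"

text \<open>After scaling, coordinate \<open>j\<close> is 1 or -1 and is represented exactly for
  every \<open>q\<close>, so Dirichlet's theorem handles only the other \<open>n\<close> coordinates
  and yields \<open>q \<le> N ^ n\<close>. Exactness at \<open>j\<close> is what makes this
  coordinate of the next residual vanish; an error below 1 sends zero entries to zero.\<close>

lemma direction_approximation:
  fixes c :: "nat \<Rightarrow> real"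
  assumes N: "N > 0" and j: "j \<le> n" "c j \<noteq> 0" and max: "\<And>i. i \<le> n \<Longrightarrow> \<bar>c i\<bar> \<le> \<bar>c j\<bar>"
  obtains q :: int and p :: "nat \<Rightarrow> int" where "0 < q" "q \<le> int (N ^ n)"
    "\<And>i. i \<le> n \<Longrightarrow> \<bar>of_int q * c i / \<bar>c j\<bar> - of_int (p i)\<bar> \<le> 1 / real N"
    "\<And>i. i \<le> n \<Longrightarrow> c i = 0 \<Longrightarrow> p i = 0"
    "of_int (p j) * \<bar>c j\<bar> = of_int q * c j"
    "\<And>i. i \<le> n \<Longrightarrow> \<bar>p i\<bar> \<le> q"
proof -
  define M where "M = \<bar>c j\<bar>"
  have M: "M > 0" using j by (simp add: M_def)
  \<comment> \<open>\<open>if i < j then i else Suc i\<close> enumerates the indices up to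
    \<open>n\<close> other than \<open>j\<close>; the definition of \<open>p\<close> undoes this
    shift.\<close>
  obtain q p0 where q: "0 < q" "q \<le> int (N ^ n)"
    and p0: "\<And>i. i < n \<Longrightarrow> \<bar>of_int q * (c (if i < j then i else Suc i) / M) - of_int (p0 i)\<bar> < 1 / real N"
    using Dirichlet_approx_simult[OF N, of n "\<lambda>i. c (if i < j then i else Suc i) / M"] by auto
  define p where "p i = (if i < j then p0 i else if i = j then (if c j > 0 then q else - q) else p0 (i - 1))" for i
  have N1: "1 / real N \<le> 1" using N by simp
  have pj: "of_int (p j) * M = of_int q * c j" using j by (simp add: p_def M_def)
  have close: "\<bar>of_int q * c i / M - of_int (p i)\<bar> < 1 / real N" if "i \<le> n" for i
  proof -
    consider "i < j" | "i = j" | "j < i" by linarith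
    then show ?thesis
    proof cases
      case 1
      then show ?thesis using p0[of i] j by (simp add: p_def)
    next
      case 2
      have "of_int q * c j / M = of_int (p j)" using pj M by (simp add: field_simps)
      then show ?thesis using 2 N by simp
    next
      case 3
      then show ?thesis using p0[of "i - 1"] that by (cases i) (auto simp: p_def)
    qed
  qed
  have "p i = 0" if "i \<le> n" "c i = 0" for i
    using close[OF that(1)] that(2) N1 by simp
  moreover have "\<bar>p i\<bar> \<le> q" if "i \<le> n" for i
  proof -
    have "\<bar>of_int q * c i / M\<bar> \<le> of_int q"
      using max[OF that] q M by (simp add: M_def abs_mult field_simps)
    moreover have "\<bar>y\<bar> \<le> of_int q \<Longrightarrow> \<bar>y - of_int (p i)\<bar> < 1 / real N \<Longrightarrow> \<bar>real_of_int (p i)\<bar> < of_int q + 1" for y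
      using N1 by linarith
    ultimately have "\<bar>real_of_int (p i)\<bar> < of_int q + 1" using close[OF that] by blast
    then show ?thesis by linarith
  qed
  ultimately show ?thesis
    using that[of q p] q pj close less_imp_le unfolding M_def by metis
qed

locale ball_scale =
  fixes n R :: nat
  assumes n: "1 \<le> n" and R: "1 \<le> R"
begin

text \<open>\<open>Q\<close> bounds the approximating vectors and \<open>D\<close> the tail; \<open>\<epsilon>\<close> is the error that averaging over
  \<open>n + 1\<close> edges can absorb.\<close>

definition B :: nat where "B = 10 * n * R"
definition Q :: int where "Q = int (B ^ n)"
definition D :: int where "D = 3 * int B * Q"
definition \<epsilon> :: real where "\<epsilon> = 1 / (2 * (real n + 1))"

lemma B_ge: "10 * n \<le> B" "10 * R \<le> B" "10 \<le> B"
proof -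
  have "1 \<le> n * R" using n R by simp
  then show "10 \<le> B" by (simp add: B_def)
qed (use n R in \<open>auto simp: B_def\<close>)

lemma Q_ge: "10 \<le> Q"
proof -
  have "B ^ 1 \<le> B ^ n" using B_ge(3) n by (intro power_increasing) auto
  then have "10 \<le> B ^ n" using B_ge(3) unfolding power_one_right by linarith
  then have "int 10 \<le> int (B ^ n)" by (simp only: of_nat_le_iff)
  then show ?thesis by (simp add: Q_def)
qed

lemma D_pos: "0 < D"
  using Q_ge B_ge(3) by (simp add: D_def)

text \<open>In the form \<open>R + 1 \<le> B * \<epsilon>\<close>, this lets the leading vector of a
  lexicographic combination dominate the rest on the ball.\<close>

lemma nR_ineq: "2 * (real n + 1) * (real R + 1) \<le> real B"
proof -
  have "2 * (real n + 1) * (real R + 1) \<le> 2 * (2 * real n) * (2 * real R)"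
    using n R by (intro mult_mono) auto
  also have "\<dots> \<le> real B" by (simp add: B_def)
  finally show ?thesis .
qed

text \<open>The first summand is the Dirichlet error \<open>1 / B\<close> evaluated on the ball; the
  second is a margin that becomes 1 after multiplication by \<open>20 * n\<close>.\<close>

lemma error_eps: "(real R + 1) / real B + 1 / (20 * real n) \<le> \<epsilon>"
proof -
  have "(real R + 1) / real B \<le> (2 * real R) / real B" using R by (intro divide_right_mono) auto
  also have "\<dots> = 1 / (5 * real n)" using R n by (simp add: B_def field_simps)
  finally have "(real R + 1) / real B + 1 / (20 * real n) \<le> 1 / (5 * real n) + 1 / (20 * real n)" by simp
  also have "\<dots> = 1 / (4 * real n)" using n by (simp add: field_simps)
  also have "\<dots> \<le> \<epsilon>" using n by (simp add: \<epsilon>_def field_simps)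
  finally show ?thesis .
qed

text \<open>\<open>c\<close> is the real residual after \<open>t\<close> rounds, and \<open>w\<close> is \<open>v\<close> minus the multiples \<open>\<lfloor>\<alpha>\<^sub>i\<rfloor> p\<^sub>i\<close>, so
  that each round moves \<open>w\<close> away from \<open>c\<close> by at most \<open>Q\<close>.  When \<open>c\<close> has become small, \<open>w\<close> is the tail.\<close>

lemma chain_exists_residual:
  fixes c :: "nat \<Rightarrow> real"
  assumes "card {i. i \<le> n \<and> c i \<noteq> 0} \<le> s" "t + s \<le> n + 1"
    and "\<And>i. i \<le> n \<Longrightarrow> \<bar>of_int (w i) - c i\<bar> \<le> real t * of_int Q"
    and "\<And>x. x \<in> X \<Longrightarrow> norm1 n x \<le> real R"
    and "\<And>x. x \<in> X \<Longrightarrow> evr n c x = ev n v x"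
    and "\<And>x. x \<in> X \<Longrightarrow> ev n w x = ev n v x"
  shows "\<exists>ps a. length ps \<le> s \<and> (\<forall>p\<in>set ps. \<forall>i\<le>n. \<bar>p i\<bar> \<le> Q) \<and>
    (\<forall>i\<le>n. \<bar>a i\<bar> \<le> D) \<and> chain n \<epsilon> v X ps a"
  using assms
proof (induction s arbitrary: c w t X)
  case (0 c w t X)
  note prems = 0
  have "c i = 0" if "i \<le> n" for i using prems(1) that by simp
  moreover have "real t * of_int Q \<le> of_int D"
  proof -
    have "int t \<le> 3 * int B" using prems(2) B_ge n by linarith
    then have "int t * Q \<le> D" unfolding D_def using Q_ge by (intro mult_right_mono) auto
    then show ?thesis using of_int_le_iff[of "int t * Q" D, where ?'a = real] by simp
  qed
  ultimately have "\<bar>w i\<bar> \<le> D" if "i \<le> n" for i using prems(3)[OF that] that by fastforce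
  then show ?case using prems(6) by (intro exI[of _ "[]"] exI[of _ w]) simp
next
  case (Suc s c w t X)
  note prems = Suc.prems
  show ?case
  \<comment> \<open>Below the threshold the integer vector \<open>w\<close> is within
    \<open>D\<close>, as \<open>20 * n + t \<le> 3 * B\<close>; above it the multiplier
    \<open>\<alpha>\<close> is at least \<open>20 * n\<close>.\<close>
  proof (cases "\<forall>i\<le>n. \<bar>c i\<bar> \<le> 20 * real n * of_int Q")
    case True
    have "\<bar>w i\<bar> \<le> D" if i: "i \<le> n" for i
    proof -
      have "\<bar>real_of_int (w i)\<bar> \<le> (20 * real n + real t) * of_int Q"
        unfolding distrib_right using True[rule_format, OF i] prems(3)[OF i] by linarith
      moreover have "20 * int n + int t \<le> 3 * int B" using prems(2) B_ge n by linarith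
      then have "(20 * int n + int t) * Q \<le> D" unfolding D_def using Q_ge by (intro mult_right_mono) auto
      then have "(20 * real n + real t) * of_int Q \<le> of_int D"
        using of_int_le_iff[of "(20 * int n + int t) * Q" D, where ?'a = real] by simp
      ultimately show ?thesis by linarith
    qed
    then show ?thesis using prems(6) by (intro exI[of _ "[]"] exI[of _ w]) simp
  next
    case False
    have "Max ((\<lambda>i. \<bar>c i\<bar>) ` {..n}) \<in> (\<lambda>i. \<bar>c i\<bar>) ` {..n}" by (rule Max_in) auto
    from imageE[OF this] obtain j where j': "j \<le> n" "Max ((\<lambda>i. \<bar>c i\<bar>) ` {..n}) = \<bar>c j\<bar>" by blast
    have j: "j \<in> {..n}" "\<And>i. i \<in> {..n} \<Longrightarrow> \<bar>c i\<bar> \<le> \<bar>c j\<bar>"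
      using j'(1) by (simp, subst j'(2)[symmetric], intro Max_ge) auto
    define M where "M = \<bar>c j\<bar>"
    have M: "M > 20 * real n * of_int Q" using False j by (force simp: M_def)
    have M0: "M > 0" using M Q_ge by (smt (verit) mult_nonneg_nonneg of_int_0_le_iff of_nat_0_le_iff)
    obtain q p where q: "0 < q" "q \<le> Q"
      and close: "\<And>i. i \<le> n \<Longrightarrow> \<bar>of_int q * c i / M - of_int (p i)\<bar> \<le> 1 / real B"
      and p0: "\<And>i. i \<le> n \<Longrightarrow> c i = 0 \<Longrightarrow> p i = 0"
      and pj: "of_int (p j) * M = of_int q * c j"
      and pq: "\<And>i. i \<le> n \<Longrightarrow> \<bar>p i\<bar> \<le> q"
      using direction_approximation[of B j n c] B_ge(3) j M0 unfolding M_def Q_def by auto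
    \<comment> \<open>Since \<open>p / q\<close> approximates \<open>c / M\<close>, the residual
      \<open>c\<close> is close to \<open>\<alpha>\<close> times \<open>p\<close>.\<close>
    define \<alpha> where "\<alpha> = M / of_int q"
    have \<alpha>: "\<alpha> \<ge> 20 * real n"
    proof -
      have "20 * real n * of_int q \<le> 20 * real n * of_int Q" using q by (intro mult_left_mono) auto
      then show ?thesis using M q by (simp add: \<alpha>_def field_simps)
    qed
    have \<alpha>0: "\<alpha> > 0" using M0 q by (simp add: \<alpha>_def)
    have qc: "of_int q * y / M = y / \<alpha>" for y using M0 q by (simp add: \<alpha>_def)
    define c' where "c' i = c i - \<alpha> * of_int (p i)" for i
    define w' where "w' i = w i - \<lfloor>\<alpha>\<rfloor> * p i" for i
    let ?X = "X \<inter> {x. ev n p x = 0}"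
    have "\<exists>ps a. length ps \<le> s \<and> (\<forall>p\<in>set ps. \<forall>i\<le>n. \<bar>p i\<bar> \<le> Q) \<and>
      (\<forall>i\<le>n. \<bar>a i\<bar> \<le> D) \<and> chain n \<epsilon> v ?X ps a"
    proof (rule Suc.IH[where c = c' and w = w' and t = "Suc t"])
      have cj: "c' j = 0" using pj q by (simp add: c'_def \<alpha>_def field_simps)
      have "{i. i \<le> n \<and> c' i \<noteq> 0} \<subset> {i. i \<le> n \<and> c i \<noteq> 0}"
      proof
        show "{i. i \<le> n \<and> c' i \<noteq> 0} \<subseteq> {i. i \<le> n \<and> c i \<noteq> 0}" using p0 by (auto simp: c'_def)
        show "{i. i \<le> n \<and> c' i \<noteq> 0} \<noteq> {i. i \<le> n \<and> c i \<noteq> 0}" using j cj M0 by (auto simp: M_def)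
      qed
      then have "card {i. i \<le> n \<and> c' i \<noteq> 0} < card {i. i \<le> n \<and> c i \<noteq> 0}"
        by (intro psubset_card_mono) auto
      then show "card {i. i \<le> n \<and> c' i \<noteq> 0} \<le> s" using prems(1) by simp
      show "Suc t + s \<le> n + 1" using prems(2) by simp
      show "\<bar>of_int (w' i) - c' i\<bar> \<le> real (Suc t) * of_int Q" if i: "i \<le> n" for i
      proof -
        have "of_int (w' i) - c' i = (of_int (w i) - c i) + (\<alpha> - of_int \<lfloor>\<alpha>\<rfloor>) * of_int (p i)"
          by (simp add: w'_def c'_def algebra_simps)
        moreover have "\<bar>(\<alpha> - of_int \<lfloor>\<alpha>\<rfloor>) * real_of_int (p i)\<bar> \<le> 1 * of_int Q"
          unfolding abs_mult using pq[OF i] q by (intro mult_mono) linarith+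
        ultimately show ?thesis using prems(3)[OF i] by (simp add: distrib_right)
      qed
      fix x assume x: "x \<in> ?X"
      then have p: "evr n (\<lambda>i. of_int (p i)) x = 0" by (simp add: ev_eq_evr)
      show "norm1 n x \<le> real R" using prems(4) x by blast
      show "evr n c' x = ev n v x" unfolding c'_def evr_diff evr_cmult p using prems(5) x by simp
      show "ev n w' x = ev n v x"
        unfolding ev_eq_evr[of n w'] w'_def of_int_diff of_int_mult evr_diff evr_cmult p
        using prems(6) x by (simp add: ev_eq_evr[of n w])
    qed
    then obtain ps a where ps: "length ps \<le> s" "\<forall>p\<in>set ps. \<forall>i\<le>n. \<bar>p i\<bar> \<le> Q"
      "\<forall>i\<le>n. \<bar>a i\<bar> \<le> D" "chain n \<epsilon> v ?X ps a" by blast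
    have "(ev n p x \<le> - \<epsilon> \<longrightarrow> ev n v x \<le> 0) \<and> (\<epsilon> \<le> ev n p x \<longrightarrow> 1 \<le> ev n v x)" if x: "x \<in> X" for x
    proof -
      \<comment> \<open>The approximation error at \<open>x\<close>: \<open>ev n v x\<close> is
        \<open>\<alpha>\<close> times \<open>ev n p x + e\<close>, and \<open>e\<close> is too small
        to change the sign once \<open>ev n p x\<close> is at least \<open>\<epsilon>\<close> in
        absolute value.\<close>
      define e where "e = evr n (\<lambda>i. c i / \<alpha> - of_int (p i)) x"
      have "\<bar>e\<bar> \<le> (real R + 1) * (1 / real B)"
        unfolding e_def using close prems(4)[OF x] by (intro abs_evr_le) (simp_all add: qc)
      then have e: "\<bar>e\<bar> + 1 / (20 * real n) \<le> \<epsilon>" using error_eps by simp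
      have "e = evr n c x / \<alpha> - ev n p x"
        using evr_cmult[of n "1 / \<alpha>" c x] by (simp add: e_def evr_diff ev_eq_evr)
      then have v: "ev n v x = \<alpha> * (ev n p x + e)" using prems(5)[OF x] \<alpha>0 by (simp add: field_simps)
      have n0: "1 / (20 * real n) > 0" using n by simp
      show ?thesis
      proof (intro conjI impI)
        assume "ev n p x \<le> - \<epsilon>"
        then have "ev n p x + e \<le> 0" using e n0 by linarith
        then show "ev n v x \<le> 0" unfolding v using \<alpha>0 by (simp add: mult_nonneg_nonpos)
      next
        \<comment> \<open>A right edge demands the value 1, not mere positivity, which is why the
          margin and the lower bound on \<open>\<alpha>\<close> are kept.\<close>
        assume "\<epsilon> \<le> ev n p x"
        then have "1 / (20 * real n) \<le> ev n p x + e" using e by linarith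
        then have "20 * real n * (1 / (20 * real n)) \<le> ev n v x"
          unfolding v using \<alpha> \<alpha>0 n0 by (intro mult_mono) auto
        then show "1 \<le> ev n v x" using n by simp
      qed
    qed
    then have "chain n \<epsilon> v X (p # ps) a" using ps(4) by simp
    moreover have "\<forall>i\<le>n. \<bar>p i\<bar> \<le> Q" using pq q by fastforce
    ultimately show ?thesis using ps by (intro exI[of _ "p # ps"] exI[of _ a]) simp
  qed
qed

lemma chain_exists:
  assumes "\<And>x. x \<in> X \<Longrightarrow> norm1 n x \<le> real R"
  shows "\<exists>ps a. length ps \<le> n + 1 \<and> (\<forall>p\<in>set ps. \<forall>i\<le>n. \<bar>p i\<bar> \<le> Q) \<and>
    (\<forall>i\<le>n. \<bar>a i\<bar> \<le> D) \<and> chain n \<epsilon> v X ps a"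
proof (rule chain_exists_residual[where c = "\<lambda>i. of_int (v i)" and w = v and t = 0])
  have "card {i. i \<le> n \<and> real_of_int (v i) \<noteq> 0} \<le> card {..n}" by (intro card_mono) auto
  then show "card {i. i \<le> n \<and> real_of_int (v i) \<noteq> 0} \<le> n + 1" by simp
qed (use assms in \<open>simp_all add: ev_eq_evr\<close>)

section \<open>Lexicographic combinations of the expansion vectors\<close>

text \<open>The weight of \<open>p\<close> is \<open>B\<close> times the entry bound of the
  remaining combination, so on the ball \<open>p\<close> decides the sign unless
  \<open>ev n p x\<close> is within \<open>\<epsilon>\<close> of zero.\<close>

primrec comb :: "(nat \<Rightarrow> int) list \<Rightarrow> (nat \<Rightarrow> int) \<Rightarrow> nat \<Rightarrow> int" where
  "comb [] a = a"
| "comb (p # ps) a = (\<lambda>i. int B * D ^ (length ps + 1) * p i + comb ps a i)"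

text \<open>Each vector costs one factor \<open>D\<close>, since the recursion multiplies the bound
  by \<open>B * Q + 1 \<le> D\<close>.\<close>

lemma comb_bound:
  assumes "\<forall>p\<in>set ps. \<forall>i\<le>n. \<bar>p i\<bar> \<le> Q" "\<forall>i\<le>n. \<bar>a i\<bar> \<le> D" "i \<le> n"
  shows "\<bar>comb ps a i\<bar> \<le> D ^ (length ps + 1)"
  using assms(1)
proof (induction ps)
  case Nil
  then show ?case using assms by simp
next
  case (Cons p ps)
  let ?W = "D ^ (length ps + 1)"
  have W: "?W > 0" using D_pos by simp
  have IH: "\<bar>comb ps a i\<bar> \<le> ?W" using Cons by simp
  have p: "\<bar>p i\<bar> \<le> Q" using Cons.prems assms(3) by simp
  have "\<bar>comb (p # ps) a i\<bar> \<le> \<bar>int B * ?W * p i\<bar> + ?W"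
    using IH by (simp only: comb.simps)
  also have "\<bar>int B * ?W * p i\<bar> = int B * ?W * \<bar>p i\<bar>"
    using W by (simp only: abs_mult abs_of_pos of_nat_0_le_iff abs_of_nonneg)
  also have "\<dots> \<le> int B * ?W * Q" using p W by (intro mult_left_mono) auto
  also have "int B * ?W * Q + ?W = (int B * Q + 1) * ?W" by (simp add: algebra_simps)
  also have "\<dots> \<le> D * ?W"
  proof (intro mult_right_mono)
    have "1 * 1 \<le> int B * Q" using Q_ge B_ge(3) by (intro mult_mono) auto
    then show "int B * Q + 1 \<le> D" unfolding D_def mult.assoc by linarith
  qed (use W in simp)
  finally show ?case by simp
qed

lemma ev_comb_Cons:
  "ev n (comb (p # ps) a) x = of_int (int B * D ^ (length ps + 1)) * ev n p x + ev n (comb ps a) x"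
  unfolding ev_eq_evr comb.simps of_int_add evr_add of_int_mult[of _ "p _"] evr_cmult by (rule refl)

lemma ev_comb_tail:
  assumes "\<forall>p\<in>set ps. \<forall>i\<le>n. \<bar>p i\<bar> \<le> Q" "\<forall>i\<le>n. \<bar>a i\<bar> \<le> D" "norm1 n x \<le> real R"
  shows "\<bar>ev n (comb ps a) x\<bar> \<le> of_int (int B * D ^ (length ps + 1)) * \<epsilon>"
proof -
  let ?W = "real_of_int (D ^ (length ps + 1))"
  have W: "?W > 0" using D_pos by simp
  have "\<bar>real_of_int (comb ps a i)\<bar> \<le> ?W" if "i \<le> n" for i
    using comb_bound[OF assms(1,2) that] of_int_le_iff[of "\<bar>comb ps a i\<bar>", where ?'a = real] by (metis of_int_abs)
  then have "\<bar>ev n (comb ps a) x\<bar> \<le> (real R + 1) * ?W"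
    unfolding ev_eq_evr using assms(3) by (rule abs_evr_le)
  also have "\<dots> \<le> (real B * \<epsilon>) * ?W"
    using nR_ineq W by (intro mult_right_mono) (auto simp: \<epsilon>_def field_simps)
  finally show ?thesis by (simp add: mult_ac)
qed

text \<open>A nonpositive combination bounds the leading term by the tail, giving
  \<open>ev n p x \<le> \<epsilon>\<close>; the chain supplies the implication at
  \<open>- \<epsilon>\<close>. Where \<open>p\<close> vanishes, the combination reduces to that of
  the remaining vectors, down to the exact tail.\<close>

lemma comb_resolves_left:
  assumes "\<forall>p\<in>set ps. \<forall>i\<le>n. \<bar>p i\<bar> \<le> Q" "\<forall>i\<le>n. \<bar>a i\<bar> \<le> D"
    and "\<And>x. x \<in> X \<Longrightarrow> norm1 n x \<le> real R" "chain n \<epsilon> v X ps a"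
  shows "resolves n \<epsilon> (X \<inter> {x. ev n (comb ps a) x \<le> 0}) ps {x. ev n v x \<le> 0}"
  using assms(1,3,4)
proof (induction ps arbitrary: X)
  case Nil
  then show ?case by auto
next
  case (Cons p ps)
  let ?W = "real_of_int (int B * D ^ (length ps + 1))"
  have W: "?W > 0" using D_pos B_ge(3) by simp
  have bd: "\<forall>p\<in>set ps. \<forall>i\<le>n. \<bar>p i\<bar> \<le> Q" using Cons.prems(1) by simp
  have ch: "chain n \<epsilon> v (X \<inter> {x. ev n p x = 0}) ps a" using Cons.prems(3) by simp
  have "ev n p x \<le> \<epsilon>" if "x \<in> X" "ev n (comb (p # ps) a) x \<le> 0" for x
  proof -
    have "?W * ev n p x \<le> ?W * \<epsilon>"
      using that(2) ev_comb_tail[OF bd assms(2) Cons.prems(2)[OF that(1)]] unfolding ev_comb_Cons by linarith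
    then show ?thesis using W by (simp only: mult_le_cancel_left_pos)
  qed
  moreover have "ev n v x \<le> 0" if "x \<in> X" "ev n p x \<le> - \<epsilon>" for x
    using Cons.prems(3) that by simp
  moreover have "X \<inter> {x. ev n (comb (p # ps) a) x \<le> 0} \<inter> {x. ev n p x = 0}
    = (X \<inter> {x. ev n p x = 0}) \<inter> {x. ev n (comb ps a) x \<le> 0}" by (auto simp: ev_comb_Cons simp del: comb.simps)
  moreover have "resolves n \<epsilon> ((X \<inter> {x. ev n p x = 0}) \<inter> {x. ev n (comb ps a) x \<le> 0}) ps {x. ev n v x \<le> 0}"
    using Cons.IH[OF bd _ ch] Cons.prems(2) by blast
  ultimately show ?case by (simp del: comb.simps)
qed

lemma ev_uminus: "ev n (\<lambda>i. - p i) x = - ev n p x"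
  by (simp add: ev_def lin_uminus)

text \<open>Mirror image of the left edge: negating the vectors turns the clause of the chain at
  \<open>\<epsilon>\<close> into the one required at \<open>- \<epsilon>\<close>.\<close>

lemma comb_resolves_right:
  assumes "\<forall>p\<in>set ps. \<forall>i\<le>n. \<bar>p i\<bar> \<le> Q" "\<forall>i\<le>n. \<bar>a i\<bar> \<le> D"
    and "\<And>x. x \<in> X \<Longrightarrow> norm1 n x \<le> real R" "chain n \<epsilon> v X ps a"
  shows "resolves n \<epsilon> (X \<inter> {x. 1 \<le> ev n (comb ps a) x}) (map (\<lambda>p i. - p i) ps) {x. 1 \<le> ev n v x}"
  using assms(1,3,4)
proof (induction ps arbitrary: X)
  case Nil
  then show ?case by auto
next
  case (Cons p ps)
  let ?W = "real_of_int (int B * D ^ (length ps + 1))"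
  have W: "?W > 0" using D_pos B_ge(3) by simp
  have bd: "\<forall>p\<in>set ps. \<forall>i\<le>n. \<bar>p i\<bar> \<le> Q" using Cons.prems(1) by simp
  have ch: "chain n \<epsilon> v (X \<inter> {x. ev n p x = 0}) ps a" using Cons.prems(3) by simp
  have "- ev n p x \<le> \<epsilon>" if "x \<in> X" "1 \<le> ev n (comb (p # ps) a) x" for x
  proof -
    have "?W * (- ev n p x) \<le> ?W * \<epsilon>"
      using that(2) ev_comb_tail[OF bd assms(2) Cons.prems(2)[OF that(1)]]
      unfolding ev_comb_Cons mult_minus_right by linarith
    then show ?thesis using W by (simp only: mult_le_cancel_left_pos)
  qed
  moreover have "1 \<le> ev n v x" if "x \<in> X" "\<epsilon> \<le> ev n p x" for x
    using Cons.prems(3) that by simp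
  moreover have "X \<inter> {x. 1 \<le> ev n (comb (p # ps) a) x} \<inter> {x. - ev n p x = 0}
    = (X \<inter> {x. ev n p x = 0}) \<inter> {x. 1 \<le> ev n (comb ps a) x}" by (auto simp: ev_comb_Cons simp del: comb.simps)
  moreover have "resolves n \<epsilon> ((X \<inter> {x. ev n p x = 0}) \<inter> {x. 1 \<le> ev n (comb ps a) x})
      (map (\<lambda>p i. - p i) ps) {x. 1 \<le> ev n v x}"
    using Cons.IH[OF bd _ ch] Cons.prems(2) by blast
  ultimately show ?case by (simp add: ev_uminus del: comb.simps)
qed

end

section \<open>Bit-sizes of trees and labels\<close>

lemma all_edges_mono:
  "all_edges P T \<Longrightarrow> (\<And>a b. P a b \<Longrightarrow> P' a b) \<Longrightarrow> all_edges P' T"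
  by (induction T) auto

text \<open>An internal node contributes itself, two edges and three labels, its own label being
  that of its left edge.\<close>

lemma tbits_le:
  assumes "all_edges (\<lambda>a b. real (bits_ineq n a b) \<le> w) T" "0 \<le> w"
  shows "real (tbits n T) \<le> real (tsize T) * (3 + 3 * w)"
  using assms
proof (induction T)
  case (Node a b l r)
  then have "real (tbits n l) \<le> real (tsize l) * (3 + 3 * w)" "real (tbits n r) \<le> real (tsize r) * (3 + 3 * w)"
    "real (bits_ineq n a b) \<le> w" "real (bits_ineq n (\<lambda>i. - a i) (- b - 1)) \<le> w" by auto
  then show ?case by (simp add: distrib_right)
qed auto

text \<open>The constant 3 collects the leading 1, the loss from rounding up, and one bit for the
  denominator 1.\<close>

lemma bits_rat_le:
  assumes "\<bar>a\<bar> \<le> Z"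
  shows "real (bits_rat (of_int a)) \<le> 3 + log 2 (of_int (Z + 1))"
proof -
  have "0 \<le> log 2 (real_of_int (\<bar>a\<bar> + 1))" by (simp add: zero_le_log_cancel_iff)
  then have "real (nat \<lceil>log 2 (real_of_int (\<bar>a\<bar> + 1))\<rceil>) \<le> log 2 (real_of_int (\<bar>a\<bar> + 1)) + 1"
    by (simp add: of_nat_nat)
  also have "log 2 (real_of_int (\<bar>a\<bar> + 1)) \<le> log 2 (of_int (Z + 1))"
    using assms by (subst log_le_cancel_iff) linarith+
  finally show ?thesis by (simp add: bits_rat_def)
qed

lemma bits_ineq_le:
  assumes "bounded_edge n Z a b"
  shows "real (bits_ineq n a b) \<le> real n + (real n + 1) * (3 + log 2 (of_int (Z + 1)))"
proof -
  have "(\<Sum>i<n. real (bits_rat (of_int (a i)))) \<le> (\<Sum>i<n. 3 + log 2 (of_int (Z + 1)))"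
    using assms by (intro sum_mono bits_rat_le) (auto simp: bounded_edge_def)
  moreover have "real (bits_rat (of_int b)) \<le> 3 + log 2 (of_int (Z + 1))"
    using assms by (intro bits_rat_le) (auto simp: bounded_edge_def)
  ultimately show ?thesis by (simp add: bits_ineq_def bits_vec_def distrib_right)
qed

section \<open>Recursive relabelling of the tree\<close>

context ball_scale
begin

text \<open>\<open>D ^ (n + 2)\<close> bounds a combination of up to \<open>n + 1\<close> vectors
  and a tail; the 1 is for the right-hand side of the opposite edge.\<close>

definition Z :: int where "Z = D ^ (n + 2) + 1"

lemma D_le_Z: "D \<le> Z - 1"
  using D_pos power_increasing[of 1 "n + 2" D] by (simp add: Z_def)

lemma Q_le_Z: "Q + 1 \<le> Z"
proof -
  have "1 * Q \<le> (3 * int B) * Q" using B_ge(3) Q_ge by (intro mult_right_mono) auto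
  then show ?thesis using D_le_Z by (simp add: D_def)
qed

text \<open>\<open>S\<close> is the new cell and \<open>E\<close> records the path, so validity of
  \<open>T\<close> is assumed on the part of \<open>S\<close> obeying the original inequalities.
  Separate label costs \<open>w\<^sub>0\<close> and \<open>w\<close> are kept because up to
  \<open>4 * n + 5\<close> nodes per leaf carry short labels and only one node per internal node of
  \<open>T\<close> carries a long one.\<close>

lemma convert_tree:
  fixes w\<^sub>0 w :: real and E :: "((nat \<Rightarrow> int) list \<times> (nat \<Rightarrow> real) set) list"
  assumes w0: "0 \<le> w\<^sub>0" "\<And>a b. bounded_edge n (Q + 1) a b \<Longrightarrow> real (bits_ineq n a b) \<le> w\<^sub>0"
    and w: "0 \<le> w" "\<And>a b. bounded_edge n Z a b \<Longrightarrow> real (bits_ineq n a b) \<le> w"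
    and "convex_set S" "S \<subseteq> in_Rn n" "\<And>x. x \<in> S \<Longrightarrow> norm1 n x \<le> real R"
    and "\<And>us G. (us, G) \<in> set E \<Longrightarrow> convex_set G"
    and "\<And>us G. (us, G) \<in> set E \<Longrightarrow> resolves n \<epsilon> S us G"
    and "\<And>us G u i. (us, G) \<in> set E \<Longrightarrow> u \<in> set us \<Longrightarrow> i \<le> n \<Longrightarrow> \<bar>u i\<bar> \<le> Q"
    and "valid n (S \<inter> (\<Inter>e\<in>set E. snd e)) T"
  shows "\<exists>T'. valid n S T' \<and> tsize T' \<le> (4 * n + 5) * tsize T \<and> all_edges (bounded_edge n Z) T' \<and>
    real (tbits n T') \<le> (real (4 * n + 5) * (3 + 3 * w\<^sub>0) + 3 + 3 * w) * real (tsize T)"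
  using assms(5-)
proof (induction T arbitrary: S E)
  case (Leaf S E)
  have emp: "S \<inter> (\<Inter>e\<in>set E. snd e) = {}" using Leaf.prems(7) by simp
  have "\<exists>t. valid n S t \<and> tsize t + 4 * 0 \<le> 4 * n + 5 \<and> all_edges (bounded_edge n (Q + 1)) t"
    \<comment> \<open>No functional is pinned yet: with \<open>m = 0\<close> the family
      \<open>w\<close> is arbitrary.\<close>
    by (rule repair_leaf[OF \<epsilon>_def, where S = S and E = E and w = undefined])
      (fact Leaf.prems(1,2,4,5,6) emp | simp)+
  then obtain t where t: "valid n S t" "tsize t \<le> 4 * n + 5" "all_edges (bounded_edge n (Q + 1)) t"
    by auto
  have "real (tbits n t) \<le> real (tsize t) * (3 + 3 * w\<^sub>0)"
    by (rule tbits_le[OF all_edges_mono[OF t(3) w0(2)] w0(1)])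
  also have "\<dots> \<le> real (4 * n + 5) * (3 + 3 * w\<^sub>0)" using t(2) w0(1) by (intro mult_right_mono) linarith+
  finally have "real (tbits n t) \<le> (real (4 * n + 5) * (3 + 3 * w\<^sub>0) + 3 + 3 * w) * real (tsize Leaf)"
    using w(1) by simp
  moreover have "all_edges (bounded_edge n Z) t"
    using t(3) by (rule all_edges_mono) (use Q_le_Z in \<open>force simp: bounded_edge_def\<close>)
  ultimately show ?case using t by auto
next
  case (Node a b l r S E)
  note prems = Node.prems
  define v where "v = a(n := b)"
  have ev_v: "ev n v x = lin n a x - of_int b" for x
  proof -
    have "lin n v x = lin n a x" unfolding lin_def v_def by (intro sum.cong) auto
    then show ?thesis by (simp add: ev_def v_def)
  qed
  obtain ps c where ps: "length ps \<le> n + 1" "\<forall>p\<in>set ps. \<forall>i\<le>n. \<bar>p i\<bar> \<le> Q" "\<forall>i\<le>n. \<bar>c i\<bar> \<le> D"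
    "chain n \<epsilon> v S ps c"
    using chain_exists[of S v] prems(3) by blast
  define a' where "a' = comb ps c"
  have a'_bd: "\<bar>a' i\<bar> \<le> Z - 1" if "i \<le> n" for i
  proof -
    have "\<bar>a' i\<bar> \<le> D ^ (length ps + 1)" unfolding a'_def using comb_bound ps(2,3) that by blast
    also have "\<dots> \<le> D ^ (n + 2)" using D_pos ps(1) by (intro power_increasing) auto
    finally show ?thesis by (simp add: Z_def)
  qed
  define SL where "SL = S \<inter> {x. lin n a' x \<le> of_int (a' n)}"
  define SR where "SR = S \<inter> {x. - lin n a' x \<le> of_int (- a' n - 1)}"
  have SL: "SL = S \<inter> {x. ev n a' x \<le> 0}" by (auto simp: SL_def ev_def)
  have SR: "SR = S \<inter> {x. 1 \<le> ev n a' x}" by (auto simp: SR_def ev_def)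
  define EL where "EL = (ps, {x. ev n v x \<le> 0}) # E"
  define ER where "ER = (map (\<lambda>p i. - p i) ps, {x. 1 \<le> ev n v x}) # E"
  let ?A = "real (4 * n + 5) * (3 + 3 * w\<^sub>0) + 3 + 3 * w"
  have "\<exists>T'. valid n SL T' \<and> tsize T' \<le> (4 * n + 5) * tsize l \<and> all_edges (bounded_edge n Z) T' \<and>
    real (tbits n T') \<le> ?A * real (tsize l)"
  proof (rule Node.IH(1)[where E = EL])
    show "convex_set SL" using prems(1) convex_set_Int convex_set_ev_le SL by simp
    show "SL \<subseteq> in_Rn n" using prems(2) by (auto simp: SL_def)
    show "norm1 n x \<le> real R" if "x \<in> SL" for x using prems(3) that by (auto simp: SL_def)
    show "convex_set G" if "(us, G) \<in> set EL" for us G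
      using that prems(4) convex_set_ev_le by (auto simp: EL_def)
    show "resolves n \<epsilon> SL us G" if "(us, G) \<in> set EL" for us G
    proof (cases "(us, G) \<in> set E")
      case True
      show ?thesis by (rule resolves_antimono[OF prems(5)[OF True]]) (simp add: SL)
    next
      case False
      have "resolves n \<epsilon> SL ps {x. ev n v x \<le> 0}"
        unfolding SL a'_def using comb_resolves_left[OF ps(2,3) prems(3) ps(4)] by blast
      then show ?thesis using False that by (auto simp: EL_def)
    qed
    show "\<bar>u i\<bar> \<le> Q" if "(us, G) \<in> set EL" "u \<in> set us" "i \<le> n" for us G u i
      using that prems(6)[OF _ that(2,3)] ps(2) by (auto simp: EL_def)
    \<comment> \<open>Cutting by the new inequality as well only shrinks the original cell, so the
      old subtree remains valid.\<close>
    have "SL \<inter> (\<Inter>e\<in>set EL. snd e) \<subseteq> S \<inter> (\<Inter>e\<in>set E. snd e) \<inter> {x. lin n a x \<le> of_int b}"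
      by (auto simp: SL_def EL_def ev_v)
    then show "valid n (SL \<inter> (\<Inter>e\<in>set EL. snd e)) l"
      by (rule valid_antimono[rotated]) (use prems(7) in simp)
  qed
  then obtain L where L: "valid n SL L" "tsize L \<le> (4 * n + 5) * tsize l"
    "all_edges (bounded_edge n Z) L" "real (tbits n L) \<le> ?A * real (tsize l)" by blast
  have "\<exists>T'. valid n SR T' \<and> tsize T' \<le> (4 * n + 5) * tsize r \<and> all_edges (bounded_edge n Z) T' \<and>
    real (tbits n T') \<le> ?A * real (tsize r)"
  proof (rule Node.IH(2)[where E = ER])
    show "convex_set SR" using prems(1) convex_set_Int convex_set_ev_ge SR by simp
    show "SR \<subseteq> in_Rn n" using prems(2) by (auto simp: SR_def)
    show "norm1 n x \<le> real R" if "x \<in> SR" for x using prems(3) that by (auto simp: SR_def)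
    show "convex_set G" if "(us, G) \<in> set ER" for us G
      using that prems(4) convex_set_ev_ge by (auto simp: ER_def)
    show "resolves n \<epsilon> SR us G" if "(us, G) \<in> set ER" for us G
    proof (cases "(us, G) \<in> set E")
      case True
      show ?thesis by (rule resolves_antimono[OF prems(5)[OF True]]) (simp add: SR)
    next
      case False
      have "resolves n \<epsilon> SR (map (\<lambda>p i. - p i) ps) {x. 1 \<le> ev n v x}"
        unfolding SR a'_def using comb_resolves_right[OF ps(2,3) prems(3) ps(4)] by blast
      then show ?thesis using False that by (auto simp: ER_def)
    qed
    show "\<bar>u i\<bar> \<le> Q" if "(us, G) \<in> set ER" "u \<in> set us" "i \<le> n" for us G u i
      using that prems(6)[OF _ that(2,3)] ps(2) by (auto simp: ER_def)
    have "SR \<inter> (\<Inter>e\<in>set ER. snd e) \<subseteq> S \<inter> (\<Inter>e\<in>set E. snd e) \<inter> {x. - lin n a x \<le> of_int (- b - 1)}"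
      by (auto simp: SR_def ER_def ev_v)
    then show "valid n (SR \<inter> (\<Inter>e\<in>set ER. snd e)) r"
      by (rule valid_antimono[rotated]) (use prems(7) in simp)
  qed
  then obtain M where M: "valid n SR M" "tsize M \<le> (4 * n + 5) * tsize r"
    "all_edges (bounded_edge n Z) M" "real (tbits n M) \<le> ?A * real (tsize r)" by blast
  have "\<bar>a' i\<bar> \<le> Z" if "i < n" for i using a'_bd[of i] that by simp
  moreover have "\<bar>a' n\<bar> \<le> Z - 1" using a'_bd by simp
  ultimately have e1: "bounded_edge n Z a' (a' n)" "bounded_edge n Z (\<lambda>i. - a' i) (- a' n - 1)"
    by (auto simp: bounded_edge_def)
  show ?case
  proof (intro exI[of _ "Node a' (a' n) L M"] conjI)
    show "valid n S (Node a' (a' n) L M)" using L(1) M(1) by (simp add: SL_def SR_def)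
    show "tsize (Node a' (a' n) L M) \<le> (4 * n + 5) * tsize (Node a b l r)"
      using L(2) M(2) by (simp add: distrib_left)
    show "all_edges (bounded_edge n Z) (Node a' (a' n) L M)" using e1 L(3) M(3) by simp
    have "real (tbits n (Node a' (a' n) L M)) \<le> 3 + 3 * w + ?A * real (tsize l) + ?A * real (tsize r)"
      using w(2)[OF e1(1)] w(2)[OF e1(2)] L(4) M(4) by simp
    also have "\<dots> \<le> ?A + ?A * real (tsize l) + ?A * real (tsize r)"
      using w0(1) by simp
    also have "\<dots> = ?A * real (tsize (Node a b l r))" by (simp add: algebra_simps)
    finally show "real (tbits n (Node a' (a' n) L M)) \<le> ?A * real (tsize (Node a b l r))" .
  qed
qed

section \<open>Numerical bounds on labels and bit-sizes\<close>

lemma Q_le_pow: "Q + 2 \<le> int B ^ (n + 1)"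
proof -
  have "10 * Q \<le> int B * Q" using B_ge(3) Q_ge by (intro mult_right_mono) auto
  then show ?thesis using Q_ge by (simp add: Q_def)
qed

text \<open>\<open>2 * D = 6 * B ^ (n + 1)\<close> is at most \<open>B ^ (n + 2)\<close>; the power
  \<open>n + 2\<close> in \<open>Z\<close> then produces the exponent
  \<open>(n + 2)^2\<close>.\<close>

lemma Z_le_pow: "Z \<le> int B ^ ((n + 2)^2)"
proof -
  have D1: "1 \<le> D ^ (n + 2)" using D_pos by (intro one_le_power) simp
  have "Z \<le> 2 * D ^ (n + 2)" using D1 by (simp add: Z_def)
  also have "\<dots> \<le> 2 ^ (n + 2) * D ^ (n + 2)"
    using D1 self_le_power[of "2::int" "n + 2"] by (intro mult_right_mono) auto
  also have "\<dots> = (2 * D) ^ (n + 2)" by (simp add: power_mult_distrib)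
  also have "\<dots> \<le> (int B ^ (n + 2)) ^ (n + 2)"
  proof (rule power_mono)
    have "6 * (int B * Q) \<le> int B * (int B * Q)" using B_ge(3) Q_ge by (intro mult_right_mono) auto
    then show "2 * D \<le> int B ^ (n + 2)" by (simp add: D_def Q_def)
  qed (use D_pos in simp)
  also have "\<dots> = int B ^ ((n + 2)^2)" by (simp only: power_mult[symmetric] power2_eq_square)
  finally show ?thesis .
qed

text \<open>\<open>B\<close> is 5 times \<open>2 * n * R\<close>, and the cube of a number that is
  at least 2 exceeds 5.\<close>

lemma log_B_le: "log 2 (real B) \<le> 4 * log 2 (2 * real n * real R)"
  and log_nR_ge: "1 \<le> log 2 (2 * real n * real R)"
proof -
  let ?y = "2 * real n * real R"
  have "1 * 1 \<le> real n * real R" using n R by (intro mult_mono) auto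
  then have y: "2 \<le> ?y" by simp
  have "5 * ?y \<le> ?y ^ 3 * ?y"
    using power_mono[OF y, of 3] by (intro mult_right_mono) auto
  then have "real B \<le> ?y ^ 4" by (simp add: B_def power_numeral_reduce)
  then have "log 2 (real B) \<le> log 2 (?y ^ 4)" using B_ge(3) n R by (subst log_le_cancel_iff) auto
  then show "log 2 (real B) \<le> 4 * log 2 ?y" using y by (simp add: log_nat_power)
  have "log 2 2 \<le> log 2 ?y" using y by (subst log_le_cancel_iff) linarith+
  then show "1 \<le> log 2 ?y" by simp
qed

lemma log_pow_le:
  assumes "0 < z" "z \<le> int B ^ k"
  shows "log 2 (of_int z) \<le> 4 * real k * log 2 (2 * real n * real R)"
proof -
  have "real_of_int z \<le> real B ^ k" using assms(2) by (metis of_int_le_iff of_int_of_nat_eq of_int_power)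
  then have "log 2 (of_int z) \<le> log 2 (real B ^ k)" using assms(1) B_ge(3) by (subst log_le_cancel_iff) auto
  also have "\<dots> = real k * log 2 (real B)" using B_ge(3) by (simp add: log_nat_power)
  also have "\<dots> \<le> real k * (4 * log 2 (2 * real n * real R))" using log_B_le by (intro mult_left_mono) auto
  finally show ?thesis by simp
qed

text \<open>With exponent \<open>n + 1\<close>, each of the \<open>n + 1\<close> entries costs a
  multiple of \<open>n\<close> logarithms; \<open>23 = 1 + 2 * (3 + 8)\<close>.\<close>

lemma bits_small:
  assumes "bounded_edge n (Q + 1) a b"
  shows "real (bits_ineq n a b) \<le> 23 * real n ^ 2 * log 2 (2 * real n * real R)"
proof -
  define y where "y = log 2 (2 * real n * real R)"
  have y: "1 \<le> y" using log_nR_ge by (simp add: y_def)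
  have n1: "1 \<le> real n" using n by simp
  have "log 2 (of_int (Q + 1 + 1)) \<le> 4 * real (n + 1) * y"
    unfolding y_def using Q_le_pow Q_ge by (intro log_pow_le) auto
  then have "real (bits_ineq n a b) \<le> real n + (real n + 1) * (3 + 4 * real (n + 1) * y)"
    using bits_ineq_le[OF assms] n1 by (smt (verit) mult_left_mono)
  also have "\<dots> \<le> real n * (real n * y) + (2 * real n) * (3 * (real n * y) + 4 * (2 * real n) * y)"
  proof -
    have "1 * 1 \<le> real n * y" using n1 y by (intro mult_mono) auto
    then show ?thesis using n1 y by (intro add_mono mult_mono) auto
  qed
  also have "\<dots> = 23 * real n ^ 2 * y" by (simp add: power2_eq_square algebra_simps)
  finally show ?thesis by (simp add: y_def)
qed

text \<open>The exponent is now quadratic in \<open>n\<close>, one extra factor \<open>B\<close>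
  absorbing the increment in \<open>Z + 1\<close>; \<open>87 = 1 + 2 * (3 + 40)\<close>.\<close>

lemma bits_large:
  assumes "bounded_edge n Z a b"
  shows "real (bits_ineq n a b) \<le> 87 * real n ^ 3 * log 2 (2 * real n * real R)"
proof -
  define y where "y = log 2 (2 * real n * real R)"
  have y: "1 \<le> y" using log_nR_ge by (simp add: y_def)
  have n1: "1 \<le> real n" using n by simp
  have "1 \<le> int B ^ ((n + 2)^2)" using B_ge(3) by simp
  moreover have "2 * int B ^ ((n + 2)^2) \<le> int B * int B ^ ((n + 2)^2)"
    using B_ge(3) by (intro mult_right_mono) auto
  ultimately have "Z + 1 \<le> int B ^ ((n + 2)^2 + 1)" using Z_le_pow by simp
  then have "log 2 (of_int (Z + 1)) \<le> 4 * real ((n + 2)^2 + 1) * y"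
    unfolding y_def using D_le_Z D_pos by (intro log_pow_le) auto
  then have "real (bits_ineq n a b) \<le> real n + (real n + 1) * (3 + 4 * real ((n + 2)^2 + 1) * y)"
    using bits_ineq_le[OF assms] n1 by (smt (verit) mult_left_mono)
  also have "\<dots> \<le> real n * (real n ^ 2 * y) + (2 * real n) * (3 * (real n ^ 2 * y) + 4 * (10 * real n ^ 2) * y)"
  proof -
    have ny: "1 * 1 \<le> real n ^ 2 * y" using n1 y by (intro mult_mono) auto
    have "real n \<le> real n ^ 2" using n1 by (simp add: self_le_power)
    moreover have "real ((n + 2)^2 + 1) = real n ^ 2 + 4 * real n + 5" by (simp add: power2_sum)
    ultimately have "real ((n + 2)^2 + 1) \<le> 10 * real n ^ 2" using n1 by linarith
    then show ?thesis using ny n1 y by (intro add_mono mult_mono) auto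
  qed
  also have "\<dots> = 87 * real n ^ 3 * y" by (simp add: power2_eq_square power3_eq_cube algebra_simps)
  finally show ?thesis by (simp add: y_def)
qed

lemma small_branching_proof:
  assumes "convex_set K" "K \<subseteq> in_Rn n" "\<And>x. x \<in> K \<Longrightarrow> norm1 n x \<le> real R" "valid n K T"
  shows "\<exists>T'. valid n K T' \<and> real (tsize T') \<le> 9 * real n * real (tsize T) \<and>
    all_edges (bounded_edge n Z) T' \<and>
    real (tbits n T') \<le> 912 * real n ^ 3 * log 2 (2 * real n * real R) * real (tsize T)"
proof -
  define y where "y = log 2 (2 * real n * real R)"
  have y: "1 \<le> y" using log_nR_ge by (simp add: y_def)
  have n1: "1 \<le> real n" using n by simp
  define w\<^sub>0 where "w\<^sub>0 = 23 * real n ^ 2 * y"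
  define w where "w = 87 * real n ^ 3 * y"
  \<comment> \<open>At the root no edge has been passed, so \<open>E\<close> is empty and the cell
    is \<open>K\<close>.\<close>
  obtain T' where T': "valid n K T'" "tsize T' \<le> (4 * n + 5) * tsize T" "all_edges (bounded_edge n Z) T'"
    "real (tbits n T') \<le> (real (4 * n + 5) * (3 + 3 * w\<^sub>0) + 3 + 3 * w) * real (tsize T)"
    using convert_tree[of w\<^sub>0 w K "[]" T] assms bits_small bits_large y
    by (auto simp: w\<^sub>0_def w_def y_def)
  have n2: "real (4 * n + 5) \<le> 9 * real n" using n1 by simp
  have "real (tsize T') \<le> real (4 * n + 5) * real (tsize T)"
    using T'(2) of_nat_mono by fastforce
  also have "\<dots> \<le> 9 * real n * real (tsize T)" using n2 by (intro mult_right_mono) auto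
  finally have size: "real (tsize T') \<le> 9 * real n * real (tsize T)" .
  have "1 * 1 \<le> real n ^ 2 * y" "1 * 1 \<le> real n ^ 3 * y" using n1 y by (intro mult_mono; simp)+
  then have "real (4 * n + 5) * (3 + 3 * w\<^sub>0) + 3 + 3 * w
    \<le> 9 * real n * (3 * (real n ^ 2 * y) + 3 * w\<^sub>0) + 3 * (real n ^ 3 * y) + 3 * w"
    using n2 y by (intro add_mono mult_mono) (auto simp: w\<^sub>0_def w_def)
  \<comment> \<open>\<open>912 = 9 * (3 + 3 * 23) + 3 + 3 * 87\<close>.\<close>
  also have "\<dots> = 912 * real n ^ 3 * y"
    by (simp add: w\<^sub>0_def w_def power2_eq_square power3_eq_cube algebra_simps)
  finally have "real (tbits n T') \<le> 912 * real n ^ 3 * y * real (tsize T)"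
    using T'(4) by (meson mult_right_mono of_nat_0_le_iff order_trans)
  then show ?thesis using T' size unfolding y_def by blast
qed

end

theorem theorem1p1:
  "\<exists>C::real. \<exists>C'::real. \<forall>(n::nat) (R::nat) (K::(nat \<Rightarrow> real) set) (T::btree).
     n \<ge> 1 \<and> R \<ge> 1 \<and> K \<subseteq> in_Rn n \<and> compact K \<and> convex_set K \<and>
     (\<forall>x\<in>K. norm1 n x \<le> real R) \<and> valid n K T \<longrightarrow>
     (\<exists>T'. valid n K T' \<and>
        real (tsize T') \<le> C * real n * real (tsize T) \<and>
        all_edges (\<lambda>a b. (\<forall>i<n. real_of_int \<bar>a i\<bar> \<le> (10 * real n * real R) ^ ((n + 2)^2))
                         \<and> real_of_int \<bar>b\<bar> \<le> (10 * real n * real R) ^ ((n + 2)^2)) T' \<and>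
        real (tbits n T') \<le> C' * real n ^ 3 * log 2 (2 * real n * real R) * real (tsize T))"
proof (rule exI[of _ 9], rule exI[of _ 912], intro allI impI)
  fix n R :: nat and K :: "(nat \<Rightarrow> real) set" and T :: btree
  assume asm: "n \<ge> 1 \<and> R \<ge> 1 \<and> K \<subseteq> in_Rn n \<and> compact K \<and> convex_set K \<and>
     (\<forall>x\<in>K. norm1 n x \<le> real R) \<and> valid n K T"
  interpret ball_scale n R using asm by unfold_locales auto
  obtain T' where T': "valid n K T'" "real (tsize T') \<le> 9 * real n * real (tsize T)"
    "all_edges (bounded_edge n Z) T'"
    "real (tbits n T') \<le> 912 * real n ^ 3 * log 2 (2 * real n * real R) * real (tsize T)"
    using small_branching_proof[of K T] asm by blast
  have Z_real: "real_of_int z \<le> (10 * real n * real R) ^ ((n + 2)^2)" if "z \<le> Z" for z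
  proof -
    have "z \<le> int B ^ ((n + 2)^2)" using that Z_le_pow by linarith
    then have "real_of_int z \<le> real B ^ ((n + 2)^2)" by (metis of_int_le_iff of_int_of_nat_eq of_int_power)
    then show ?thesis by (simp add: B_def)
  qed
  have "all_edges (\<lambda>a b. (\<forall>i<n. real_of_int \<bar>a i\<bar> \<le> (10 * real n * real R) ^ ((n + 2)^2))
      \<and> real_of_int \<bar>b\<bar> \<le> (10 * real n * real R) ^ ((n + 2)^2)) T'"
    by (rule all_edges_mono[OF T'(3)]) (unfold bounded_edge_def, blast intro: Z_real)
  then show "\<exists>T'. valid n K T' \<and>
        real (tsize T') \<le> 9 * real n * real (tsize T) \<and>
        all_edges (\<lambda>a b. (\<forall>i<n. real_of_int \<bar>a i\<bar> \<le> (10 * real n * real R) ^ ((n + 2)^2))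
                         \<and> real_of_int \<bar>b\<bar> \<le> (10 * real n * real R) ^ ((n + 2)^2)) T' \<and>
        real (tbits n T') \<le> 912 * real n ^ 3 * log 2 (2 * real n * real R) * real (tsize T)"
    using T' by blast
qed

end
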